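(* Let $X=(X_n)_{n\ge 0}$ be the random walk in the sparse random environment $\omega$ built from a sequence of pairs $(\lambda_n,d_n)_{n\in\mathbb{Z}}$, $\lambda_n\in(0,1)$, $d_n\in\mathbb{N}$, started at $X_0=0$, with annealed law $\mathbb{P}$, and let $\xi_n=(1-\lambda_n)/\lambda_n$. Suppose that: (1) the sequence of pairs $(d_n,\lambda_n)_{n\in\mathbb{Z}}$ is stationary and ergodic under $P$; (2) the random variables $d_n$ are i.i.d. (the sequence $(d_n)$ is not assumed to be independent of $(\lambda_n)$); (3) $E_P(|\log \xi_0|)<+\infty$ while $E_P(\log d_0)=+\infty$. Then $\liminf_{n\to\infty} X_n=-\infty$ and $\limsup_{n\to\infty} X_n=+\infty$, $\mathbb{P}$-a.s.
   Context: Sparse environment: $(\lambda_k,d_k)_{k\in\mathbb{Z}}$ is a sequence of random pairs with joint law $P$ (expectation $E_P$), $\lambda_k\in(0,1)$, $d_k\in\mathbb{N}=\{1,2,\dots\}$. Set $a_0=0$, $a_n=\sum_{k=1}^n d_k$ for $n>0$, and $a_n=-\sum_{k=n+1}^{0}d_k$ for $n<0$ (so $a_n-a_{n-1}=d_n$ for all $n$). The sparse random environment $\omega=(\omega_n)_{n\in\mathbb{Z}}$ is $\omega_n=\lambda_k$ if $n=a_k$ for some $k\in\mathbb{Z}$, and $\omega_n=1/2$ otherwise. Random walk: given $\omega$, $(X_n)_{n\ge0}$ is the Markov chain on $\mathbb{Z}$ with $X_0=0$ that jumps from $i$ to $i+1$ with probability $\omega_i$ and from $i$ to $i-1$ with probability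 $1-\omega_i$; its law is the quenched law $P_\omega$. The annealed law is $\mathbb{P}=P\otimes P_\omega$, i.e. $\mathbb{P}(F\times G)=\int_F P_\omega(G)\,dP$. *)

theory Defs
  imports "HOL-Probability.Probability"
begin

definition stationary_sequence ::
  "'w measure \<Rightarrow> 'b measure \<Rightarrow> (int \<Rightarrow> 'w \<Rightarrow> 'b) \<Rightarrow> bool" where
  "stationary_sequence M N Y \<longleftrightarrow>
     (\<forall>k. Y k \<in> measurable M N) \<and>
     distr M (Pi\<^sub>M UNIV (\<lambda>_. N)) (\<lambda>x k. Y (k + 1) x) = distr M (Pi\<^sub>M UNIV (\<lambda>_. N)) (\<lambda>x k. Y k x)"

text \<open>Ergodicity is a property of the law of the sequence on the path space: every
  measurable set of paths that is invariant under the shift has probability 0 or 1.\<close>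

definition ergodic_sequence ::
  "'w measure \<Rightarrow> 'b measure \<Rightarrow> (int \<Rightarrow> 'w \<Rightarrow> 'b) \<Rightarrow> bool" where
  "ergodic_sequence M N Y \<longleftrightarrow>
     (\<forall>A \<in> sets (Pi\<^sub>M UNIV (\<lambda>_. N)).
        {y \<in> space (Pi\<^sub>M UNIV (\<lambda>_. N)). (\<lambda>k. y (k + 1)) \<in> A} = A \<longrightarrow>
        measure (distr M (Pi\<^sub>M UNIV (\<lambda>_. N)) (\<lambda>x k. Y k x)) A \<in> {0, 1})"

definition sparse_site :: "(int \<Rightarrow> nat) \<Rightarrow> int \<Rightarrow> int" where
  "sparse_site d n =
     (if n \<ge> 0 then \<Sum>k\<in>{1..n}. int (d k) else - (\<Sum>k\<in>{n+1..0}. int (d k)))"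

text \<open>If all \<open>d k\<close> are positive, the index \<open>k\<close> below is unique (\<open>inj_sparse_site\<close>).\<close>

definition sparse_env :: "(int \<Rightarrow> real) \<Rightarrow> (int \<Rightarrow> nat) \<Rightarrow> int \<Rightarrow> real" where
  "sparse_env l d n =
     (if \<exists>k. n = sparse_site d k then l (THE k. n = sparse_site d k) else 1 / 2)"

lemma sparse_site_step: "sparse_site d n - sparse_site d (n - 1) = int (d n)"
proof -
  consider "n \<ge> 1" | "n = 0" | "n < 0" by linarith
  then show ?thesis
  proof cases
    case 1
    then have "{1..n} = insert n {1..n - 1}" by auto
    with 1 show ?thesis by (simp add: sparse_site_def)
  next
    case 2
    then show ?thesis by (simp add: sparse_site_def)
  next
    case 3
    then have "{n..0} = insert n {n + 1..0}" by auto
    with 3 show ?thesis by (simp add: sparse_site_def)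
  qed
qed

lemma sparse_site_strict_mono:
  assumes "\<And>k. d k \<ge> 1"
  shows "strict_mono (sparse_site d)"
proof (rule strict_monoI)
  fix m n :: int
  assume "m < n"
  then show "sparse_site d m < sparse_site d n"
  proof (induction n rule: int_gr_induct)
    case base
    show ?case using sparse_site_step[of d "m + 1"] assms[of "m + 1"] by simp
  next
    case (step i)
    then show ?case using sparse_site_step[of d "i + 1"] assms[of "i + 1"] by simp
  qed
qed

lemma inj_sparse_site: "(\<And>k. d k \<ge> 1) \<Longrightarrow> inj (sparse_site d)"
  by (rule strict_mono_imp_inj_on[OF sparse_site_strict_mono])

lemma sparse_env_site: "(\<And>k. d k \<ge> 1) \<Longrightarrow> sparse_env l d (sparse_site d k) = l k"
  using inj_sparse_site[of d] by (auto simp: sparse_env_def inj_def intro!: arg_cong[of _ _ l])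

lemma measurable_sparse_env:
  fixes l :: "int \<Rightarrow> 'w \<Rightarrow> real" and d :: "int \<Rightarrow> 'w \<Rightarrow> nat"
  assumes [measurable]: "\<And>k. l k \<in> borel_measurable M" "\<And>k. d k \<in> measurable M (count_space UNIV)"
    and d: "\<And>k x. x \<in> space M \<Longrightarrow> d k x \<ge> 1"
  shows "(\<lambda>x. sparse_env (\<lambda>k. l k x) (\<lambda>k. d k x) n) \<in> borel_measurable M"
proof -
  have [measurable]: "Measurable.pred M (\<lambda>x. n = sparse_site (\<lambda>k. d k x) k)" for k
  proof -
    have "real_of_int (sparse_site (\<lambda>k. d k x) k) =
        (if k \<ge> 0 then \<Sum>j\<in>{1..k}. real (d j x) else - (\<Sum>j\<in>{k + 1..0}. real (d j x)))" for x
      by (simp add: sparse_site_def)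
    then have "n = sparse_site (\<lambda>k. d k x) k \<longleftrightarrow> real_of_int n =
        (if k \<ge> 0 then \<Sum>j\<in>{1..k}. real (d j x) else - (\<Sum>j\<in>{k + 1..0}. real (d j x)))" for x
      by (metis of_int_eq_iff)
    then show ?thesis by (cases "k \<ge> 0") simp_all
  qed
  have [measurable]: "(\<lambda>x. THE k. n = sparse_site (\<lambda>k. d k x) k) \<in> measurable M (count_space UNIV)"
  proof (rule measurable_THE[where I = UNIV])
    fix x i j
    assume "x \<in> space M" "n = sparse_site (\<lambda>k. d k x) i" "n = sparse_site (\<lambda>k. d k x) j"
    then show "i = j" using inj_sparse_site[of "\<lambda>k. d k x"] d by (auto dest: injD)
  qed simp_all
  have [measurable]: "(\<lambda>x. l (THE k. n = sparse_site (\<lambda>k. d k x) k) x) \<in> borel_measurable M"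
    by (rule measurable_compose_countable[where f = l]) measurable
  show ?thesis unfolding sparse_env_def by measurable
qed

definition walk_step :: "(int \<Rightarrow> real) \<Rightarrow> int \<Rightarrow> int pmf" where
  "walk_step w i = map_pmf (\<lambda>b. if b then i + 1 else i - 1) (bernoulli_pmf (w i))"

text \<open>The law of \<open>X\<^sub>n\<close> given \<open>X\<^sub>0, \<dots>, X\<^bsub>n-1\<^esub>\<close>, in the format of the Ionescu Tulcea theorem.\<close>

primrec walk_kernel :: "(int \<Rightarrow> real) \<Rightarrow> nat \<Rightarrow> (nat \<Rightarrow> int) \<Rightarrow> int measure" where
  "walk_kernel w 0 X = return (count_space UNIV) 0"
| "walk_kernel w (Suc n) X = measure_pmf (walk_step w (X n))"

abbreviation walk_paths :: "(nat \<Rightarrow> int) measure" where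
  "walk_paths \<equiv> Pi\<^sub>M UNIV (\<lambda>_. count_space UNIV)"

definition quenched_law :: "(int \<Rightarrow> real) \<Rightarrow> (nat \<Rightarrow> int) measure" where
  "quenched_law w = projective_family.lim UNIV
     (Ionescu_Tulcea.CI (walk_kernel w) (\<lambda>_. count_space UNIV)) (\<lambda>_. count_space UNIV)"

definition annealed_law ::
  "'w measure \<Rightarrow> ('w \<Rightarrow> int \<Rightarrow> real) \<Rightarrow> ('w \<times> (nat \<Rightarrow> int)) measure" where
  "annealed_law M w =
     M \<bind> (\<lambda>x. distr (quenched_law (w x)) (M \<Otimes>\<^sub>M walk_paths) (\<lambda>X. (x, X)))"

lemma Ionescu_Tulcea_walk: "Ionescu_Tulcea (walk_kernel w) (\<lambda>_. count_space UNIV)"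
proof (rule Ionescu_Tulcea.intro)
  show "walk_kernel w i \<in> measurable (Pi\<^sub>M {0..<i} (\<lambda>_. count_space UNIV))
      (subprob_algebra (count_space UNIV))" for i
  proof (cases i)
    case 0
    have "walk_kernel w 0 = (\<lambda>_. return (count_space UNIV) 0)" by auto
    then show ?thesis
      using 0 by (simp add: space_subprob_algebra prob_space_return prob_space_imp_subprob_space)
  next
    case (Suc n)
    have 1: "(\<lambda>X. X n) \<in> measurable (Pi\<^sub>M {0..<Suc n} (\<lambda>_. count_space UNIV)) (count_space UNIV)"
      by (rule measurable_component_singleton) simp
    have 2: "(\<lambda>i. measure_pmf (walk_step w i)) \<in>
        measurable (count_space UNIV) (subprob_algebra (count_space UNIV))"
      by (simp add: space_subprob_algebra prob_space_imp_subprob_space measure_pmf.prob_space_axioms)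
    have "walk_kernel w (Suc n) = (\<lambda>X. measure_pmf (walk_step w (X n)))" by auto
    then show ?thesis using Suc measurable_compose[OF 1 2] by simp
  qed
  show "prob_space (walk_kernel w i x)" for i x
    by (cases i) (auto intro: prob_space_return measure_pmf.prob_space_axioms)
qed

context
  fixes w :: "int \<Rightarrow> real"
begin

interpretation IT: Ionescu_Tulcea "walk_kernel w" "\<lambda>_. count_space UNIV"
  by (rule Ionescu_Tulcea_walk)

lemma sets_quenched_law [measurable_cong]: "sets (quenched_law w) = sets walk_paths"
  unfolding quenched_law_def by simp

lemma space_quenched_law [simp]: "space (quenched_law w) = UNIV"
  using sets_eq_imp_space_eq[OF sets_quenched_law] by (simp add: space_PiM)

lemma distr_quenched_law:
  "finite J \<Longrightarrow> distr (quenched_law w) (Pi\<^sub>M J (\<lambda>_. count_space UNIV)) (\<lambda>x. restrict x J) = IT.CI J"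
  unfolding quenched_law_def by (rule IT.distr_lim)

lemma prob_space_quenched_law: "prob_space (quenched_law w)"
proof (rule prob_space_distrD)
  show "(\<lambda>x. restrict x {}) \<in> measurable (quenched_law w) (Pi\<^sub>M {} (\<lambda>_. count_space UNIV))"
    by (intro measurable_restrict) auto
  show "prob_space (distr (quenched_law w) (Pi\<^sub>M {} (\<lambda>_. count_space UNIV)) (\<lambda>x. restrict x {}))"
    by (subst distr_quenched_law) (auto intro: IT.PF.prob_space_P)
qed

lemma sets_singleton_PiM:
  assumes "y \<in> extensional J" "finite J"
  shows "{y} \<in> sets (Pi\<^sub>M J (\<lambda>_. count_space (UNIV :: int set)))"
proof -
  have "{y} = Pi\<^sub>E J (\<lambda>i. {y i})"
    using assms(1) by (auto simp: PiE_iff intro: extensionalityI extensional_arb)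
  with assms(2) show ?thesis by (auto intro!: sets_PiM_I_finite)
qed

lemma emeasure_C_walk:
  assumes "y \<in> extensional {0..<Suc n}"
  shows "emeasure (IT.C 0 (Suc n) (\<lambda>_. undefined)) {y} =
    (if y 0 = 0 then \<Prod>i<n. ennreal (pmf (walk_step w (y i)) (y (Suc i))) else 0)"
proof -
  have step: "emeasure (IT.C 0 (Suc n) (\<lambda>_. undefined)) {y} =
      emeasure (walk_kernel w n (restrict y {0..<n})) {y n} *
      emeasure (IT.C 0 n (\<lambda>_. undefined)) {restrict y {0..<n}}"
    if y: "y \<in> extensional {0..<Suc n}" for n and y :: "nat \<Rightarrow> int"
  proof -
    let ?r = "restrict y {0..<n}"
    have sp: "space (IT.C 0 n (\<lambda>_. undefined)) = extensional {0..<n}"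
      by (subst IT.space_C) (auto simp: space_PiM PiE_UNIV_domain PiE_def)
    have A: "{y} \<in> sets (Pi\<^sub>M {0..<Suc n} (\<lambda>_. count_space UNIV))"
      using y by (intro sets_singleton_PiM) auto
    have B: "{?r} \<in> sets (IT.C 0 n (\<lambda>_. undefined))"
      by (subst IT.sets_C) (auto intro!: sets_singleton_PiM)
    have eq: "emeasure (IT.eP n x) {y} =
        emeasure (walk_kernel w n ?r) {y n} * indicator {?r} x"
      if x: "x \<in> extensional {0..<n}" for x
    proof -
      have "x \<in> space (Pi\<^sub>M {0..<n} (\<lambda>_. count_space UNIV))"
        using x by (auto simp: space_PiM PiE_def)
      then have 1: "emeasure (IT.eP n x) {y} =
          emeasure (walk_kernel w n x) ((\<lambda>v. x(n := v)) -` {y} \<inter> UNIV)"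
        using A by (subst IT.emeasure_eP) auto
      have 2: "(\<lambda>v. x(n := v)) -` {y} = (if x = ?r then {y n} else {})"
      proof -
        have iff: "x(n := v) = y \<longleftrightarrow> x = ?r \<and> v = y n" for v
        proof
          assume eq: "x(n := v) = y"
          have "x = ?r"
          proof (rule extensionalityI[OF x])
            show "x j = ?r j" if "j \<in> {0..<n}" for j
              using that fun_cong[OF eq, of j] by auto
          qed simp
          then show "x = ?r \<and> v = y n" using fun_cong[OF eq, of n] by simp
        next
          assume *: "x = ?r \<and> v = y n"
          show "x(n := v) = y"
          proof (rule extensionalityI[OF _ y])
            show "x(n := v) \<in> extensional {0..<Suc n}"
              using x by (auto simp: extensional_def)
            show "(x(n := v)) j = y j" if "j \<in> {0..<Suc n}" for j
              using that conjunct2[OF *] fun_cong[OF conjunct1[OF *], of j] by (cases "j = n") simp_all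
          qed
        qed
        show ?thesis
          unfolding vimage_def singleton_iff iff by (rule if_split[THEN iffD2]) blast
      qed
      show ?thesis
      proof (cases "x = ?r")
        case True
        have "emeasure (IT.eP n x) {y} = emeasure (walk_kernel w n x) {y n}"
          unfolding 1 2 if_P[OF True] by simp
        also have "walk_kernel w n x = walk_kernel w n ?r"
          by (rule arg_cong[OF True])
        finally show ?thesis using True by (simp only: indicator_simps singleton_iff mult_1_right)
      next
        case False
        have "emeasure (IT.eP n x) {y} = 0"
          unfolding 1 2 if_not_P[OF False] by simp
        then show ?thesis using False by (simp add: indicator_def)
      qed
    qed
    have "emeasure (IT.C 0 (Suc n) (\<lambda>_. undefined)) {y} =
        (\<integral>\<^sup>+x. emeasure (IT.eP n x) {y} \<partial>IT.C 0 n (\<lambda>_. undefined))"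
    proof -
      have m: "IT.eP n \<in> measurable (IT.C 0 n (\<lambda>_. undefined))
          (subprob_algebra (Pi\<^sub>M {0..<Suc n} (\<lambda>_. count_space UNIV)))"
        by (subst measurable_cong_sets[OF IT.sets_C refl]) (use IT.measurable_eP[of n] in simp_all)
      have "space (IT.C 0 n (\<lambda>_. undefined)) \<noteq> {}"
        unfolding sp by (auto intro: exI[of _ "\<lambda>_. undefined"] simp: extensional_def)
      then show ?thesis using emeasure_bind[OF _ m A] by simp
    qed
    also have "\<dots> = (\<integral>\<^sup>+x. emeasure (walk_kernel w n ?r) {y n} * indicator {?r} x
        \<partial>IT.C 0 n (\<lambda>_. undefined))"
      by (intro nn_integral_cong) (auto simp: sp eq)
    also have "\<dots> = emeasure (walk_kernel w n ?r) {y n} *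
        emeasure (IT.C 0 n (\<lambda>_. undefined)) {?r}"
      using B by (rule nn_integral_cmult_indicator)
    finally show ?thesis .
  qed
  show ?thesis using assms
  proof (induction n arbitrary: y)
    case 0
    have "emeasure (IT.C 0 0 (\<lambda>_. undefined)) {restrict y {0..<0}} = 1"
      by (auto simp: space_PiM PiM_empty restrict_def indicator_def)
    then show ?case
      by (subst step[OF 0]) (auto simp: indicator_def)
  next
    case (Suc n)
    have "restrict y {0..<Suc n} \<in> extensional {0..<Suc n}" by simp
    note IH = Suc.IH[OF this]
    show ?case
      unfolding step[OF Suc.prems] IH by (simp add: emeasure_pmf_single mult.commute)
  qed
qed

lemma emeasure_quenched_law_cylinder:
  "emeasure (quenched_law w) {X. \<forall>i\<le>n. X i = x i} =
    (if x 0 = 0 then \<Prod>i<n. ennreal (pmf (walk_step w (x i)) (x (Suc i))) else 0)"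
proof -
  let ?J = "{0..<Suc n}" and ?y = "restrict x {0..<Suc n}"
  have y: "{?y} \<in> sets (Pi\<^sub>M ?J (\<lambda>_. count_space UNIV))"
    by (intro sets_singleton_PiM) auto
  have "{X. \<forall>i\<le>n. X i = x i} = prod_emb UNIV (\<lambda>_. count_space UNIV) ?J {?y}"
  proof -
    have "(\<forall>i\<le>n. X i = x i) \<longleftrightarrow> restrict X ?J = ?y" for X
      by (auto simp: fun_eq_iff less_Suc_eq_le)
    then show ?thesis by (auto simp: prod_emb_def space_PiM)
  qed
  then have "emeasure (quenched_law w) {X. \<forall>i\<le>n. X i = x i} = emeasure (IT.CI ?J) {?y}"
    unfolding quenched_law_def using IT.lim[OF _ y] by simp
  also have "\<dots> = emeasure (IT.C 0 (Suc n) (\<lambda>_. undefined)) {?y}"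
  proof -
    have "prod_emb ?J (\<lambda>_. count_space UNIV) ?J {?y} = {?y}"
      using y by (intro prod_emb_id) (auto simp: space_PiM)
    then show ?thesis using IT.emeasure_CI[OF _ y, of "Suc n"] by simp
  qed
  also have "\<dots> = (if x 0 = 0 then \<Prod>i<n. ennreal (pmf (walk_step w (x i)) (x (Suc i))) else 0)"
    by (subst emeasure_C_walk) (auto intro!: prod.cong)
  finally show ?thesis .
qed

end

lemma pmf_walk_step:
  assumes "0 \<le> w i" "w i \<le> 1"
  shows "pmf (walk_step w i) j = (if j = i + 1 then w i else if j = i - 1 then 1 - w i else 0)"
proof -
  have inj: "inj (\<lambda>b. if b then i + 1 else i - 1)"
    by (auto simp: inj_def)
  have 1: "pmf (walk_step w i) (i + 1) = w i"
    using pmf_map_inj'[OF inj, of "bernoulli_pmf (w i)" True] assms by (simp add: walk_step_def)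
  have 2: "pmf (walk_step w i) (i - 1) = 1 - w i"
    using pmf_map_inj'[OF inj, of "bernoulli_pmf (w i)" False] assms by (simp add: walk_step_def)
  have 3: "pmf (walk_step w i) j = 0" if "j \<noteq> i + 1" "j \<noteq> i - 1"
    unfolding walk_step_def using that by (intro pmf_map_outside) auto
  from 1 2 3 show ?thesis by auto
qed

lemma measurable_quenched_law:
  assumes w: "\<And>n. (\<lambda>x. w x n) \<in> borel_measurable M"
    and w01: "\<And>x n. x \<in> space M \<Longrightarrow> 0 \<le> w x n \<and> w x n \<le> 1"
  shows "(\<lambda>x. quenched_law (w x)) \<in> measurable M (subprob_algebra walk_paths)"
proof -
  note [measurable] = w
  define Z where "Z n l = {X :: nat \<Rightarrow> int. \<forall>i\<le>n. X i = l ! i}" for n l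
  define G where "G = insert {} {Z n l |n l. True}"
  have Z_sets: "Z n l \<in> sets walk_paths" for n l
  proof -
    have "Z n l = {X \<in> space walk_paths. \<forall>i\<in>{..n}. X i = l ! i}"
      by (auto simp: Z_def space_PiM)
    also have "\<dots> \<in> sets walk_paths"
      by measurable
    finally show ?thesis .
  qed
  have stable: "Int_stable G"
  proof -
    have *: "Z n l \<inter> Z m k \<in> G" if "n \<le> m" for n m l k
    proof (cases "\<forall>i\<le>n. l ! i = k ! i")
      case True
      then have "Z n l \<inter> Z m k = Z m k" using that by (auto simp: Z_def)
      then show ?thesis by (auto simp: G_def)
    next
      case False
      then have "Z n l \<inter> Z m k = {}" using that by (force simp: Z_def)
      then show ?thesis by (simp add: G_def)
    qed
    have "Z n l \<inter> Z m k \<in> G" for n m l k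
      using *[of n m l k] *[of m n k l] by (cases "n \<le> m") (auto simp: Int_commute)
    moreover have "A = {} \<or> (\<exists>n l. A = Z n l)" if "A \<in> G" for A
      using that by (auto simp: G_def)
    moreover have "{} \<in> G" by (simp add: G_def)
    ultimately show ?thesis unfolding Int_stable_def by (metis Int_empty_left Int_empty_right)
  qed
  have sets: "sets walk_paths = sigma_sets UNIV G"
  proof
    have "(\<lambda>X. X) \<in> measurable (sigma UNIV G) walk_paths"
    proof (rule measurable_PiM_single')
      fix n :: nat
      show "(\<lambda>X. X n) \<in> measurable (sigma UNIV G) (count_space UNIV)"
      proof (rule measurableI)
        fix A :: "int set"
        have "(\<lambda>X. X n) -` A \<inter> space (sigma UNIV G) =
            (\<Union>l\<in>{l. l ! n \<in> A}. Z n l)"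
        proof (intro equalityI subsetI)
          fix X assume "X \<in> (\<lambda>X. X n) -` A \<inter> space (sigma UNIV G)"
          moreover have "map X [0..<Suc n] ! i = X i" if "i \<le> n" for i
            using that by (subst nth_map) (auto simp del: upt_Suc)
          ultimately show "X \<in> (\<Union>l\<in>{l. l ! n \<in> A}. Z n l)"
            by (intro UN_I[of "map X [0..<Suc n]"]) (auto simp: Z_def simp del: upt_Suc)
        qed (auto simp: Z_def)
        also have "\<dots> \<in> sets (sigma UNIV G)"
          by (rule sets.countable_UN') (auto simp: G_def intro!: sigma_sets.Basic)
        finally show "(\<lambda>X. X n) -` A \<inter> space (sigma UNIV G) \<in> sets (sigma UNIV G)" .
      qed auto
    qed auto
    then show "sets walk_paths \<subseteq> sigma_sets UNIV G"
      using measurable_sets[of "\<lambda>X. X" "sigma UNIV G" walk_paths] by auto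
    show "sigma_sets UNIV G \<subseteq> sets walk_paths"
      using sets.sigma_sets_subset[of G walk_paths] Z_sets by (auto simp: G_def space_PiM)
  qed
  have meas: "(\<lambda>x. emeasure (quenched_law (w x)) A) \<in> borel_measurable M" if A: "A \<in> G" for A
  proof (cases "A = {}")
    case False
    with A obtain n l where A_eq: "A = Z n l" by (auto simp: G_def)
    let ?p = "\<lambda>i j x. if j = i + 1 then w x i else if j = i - 1 then 1 - w x i else 0"
    have "(\<lambda>x. if l ! 0 = 0 then \<Prod>i<n. ennreal (?p (l ! i) (l ! Suc i) x) else 0)
        \<in> borel_measurable M"
      by measurable
    also have "?this \<longleftrightarrow> ?thesis"
      unfolding A_eq Z_def
      by (intro measurable_cong, subst emeasure_quenched_law_cylinder)
        (auto simp: pmf_walk_step w01 intro!: prod.cong)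
    finally show ?thesis .
  qed simp
  have "(\<lambda>x. quenched_law (w x)) \<in> measurable M (prob_algebra walk_paths)"
    by (rule measurable_prob_algebra_generated[OF sets stable])
      (auto simp: prob_space_quenched_law sets_quenched_law meas)
  then show ?thesis by (rule measurable_prob_algebraD)
qed

lemma emeasure_annealed_law:
  assumes "prob_space M"
    and w: "\<And>n. (\<lambda>x. w x n) \<in> borel_measurable M"
    and w01: "\<And>x n. x \<in> space M \<Longrightarrow> 0 \<le> w x n \<and> w x n \<le> 1"
    and F: "F \<in> sets M" and G: "G \<in> sets walk_paths"
  shows "emeasure (annealed_law M w) (F \<times> G) = (\<integral>\<^sup>+x\<in>F. emeasure (quenched_law (w x)) G \<partial>M)"
proof -
  let ?K = "\<lambda>x. distr (quenched_law (w x)) (M \<Otimes>\<^sub>M walk_paths) (\<lambda>X. (x, X))"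
  have K: "?K \<in> measurable M (subprob_algebra (M \<Otimes>\<^sub>M walk_paths))"
    by (rule measurable_distr2[OF _ measurable_quenched_law[OF w w01]]) simp_all
  have FG: "F \<times> G \<in> sets (M \<Otimes>\<^sub>M walk_paths)"
    using F G by simp
  have ne: "space M \<noteq> {}"
    using \<open>prob_space M\<close> by (rule prob_space.not_empty)
  have "emeasure (annealed_law M w) (F \<times> G) = (\<integral>\<^sup>+x. emeasure (?K x) (F \<times> G) \<partial>M)"
    unfolding annealed_law_def by (rule emeasure_bind[OF ne K FG])
  also have "\<dots> = (\<integral>\<^sup>+x\<in>F. emeasure (quenched_law (w x)) G \<partial>M)"
  proof (rule nn_integral_cong)
    fix x assume x: "x \<in> space M"
    have "Pair x \<in> measurable (quenched_law (w x)) (M \<Otimes>\<^sub>M walk_paths)"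
      using x by (simp add: measurable_cong_sets[OF sets_quenched_law refl])
    then have "emeasure (?K x) (F \<times> G) = emeasure (quenched_law (w x)) (Pair x -` (F \<times> G) \<inter> UNIV)"
      using emeasure_distr[OF _ FG] by (metis space_quenched_law)
    also have "Pair x -` (F \<times> G) \<inter> UNIV = (if x \<in> F then G else {})" by auto
    finally show "emeasure (?K x) (F \<times> G) =
        emeasure (quenched_law (w x)) G * indicator F x"
      by (auto simp: indicator_def)
  qed
  finally show ?thesis .
qed

end

(* Only one consequence of stationarity is needed: by the maximal ergodic inequality the
   partial sums of |ln xi_j| grow at most linearly in both directions. As E ln d_0 is infinite,
   the second Borel-Cantelli lemma makes ln d_n exceed every multiple of n infinitely often in
   both directions, so the increments of the scale function of the quenched walk over the gaps
   between consecutive sites are unbounded near both ends of the line. The probability of never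
   reaching a given site from one side is bounded and harmonic off that site, where it vanishes;
   on each gap it is linear, with slopes proportional to the products of the xi_j, so being
   bounded it must be identically 0. *)
theory Submission
  imports Defs
begin

section \<open>Bounded harmonic functions and survival probabilities on a half-line\<close>

text \<open>The increment of \<open>u\<close> over the gap to the right of
  \<open>a (k0 + int n)\<close> is the \<open>n\<close>-th quantity in \<open>unb\<close> times
  \<open>D (a k0)\<close>, and \<open>D (a k0)\<close> is nonnegative because \<open>u\<close>
  vanishes at \<open>a k0\<close>. Every such increment is at most 1 while the factors are
  unbounded, so \<open>D (a k0) = 0\<close>. The one-step recursion for \<open>D\<close> then
  carries the value 0 to the right.\<close>

lemma harmonic_eq_0:
  fixes u w :: "int \<Rightarrow> real" and a :: "int \<Rightarrow> int"
  assumes a: "strict_mono a"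
    and w: "\<And>i. 0 < w i \<and> w i < 1"
    and half: "\<And>i. i \<notin> range a \<Longrightarrow> w i = 1 / 2"
    and u: "\<And>i. 0 \<le> u i \<and> u i \<le> 1"
    and u0: "u (a k0) = 0"
    and harm: "\<And>i. a k0 < i \<Longrightarrow> u i = w i * u (i + 1) + (1 - w i) * u (i - 1)"
    and unb: "\<And>m::nat. \<exists>n::nat. real m \<le> real_of_int (a (k0 + int n + 1) - a (k0 + int n)) *
        (\<Prod>j=1..n. (1 - w (a (k0 + int j))) / w (a (k0 + int j)))"
    and i: "a k0 \<le> i"
  shows "u i = 0"
proof -
  define D where "D i = u (i + 1) - u i" for i
  have step: "D i = (1 - w i) / w i * D (i - 1)" if "a k0 < i" for i
    using harm[OF that] w[of i] by (simp add: D_def field_simps)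
  \<comment> \<open>The value formula reaches the next site, the slope formula stops strictly before
    it: at the next site the slope is multiplied by that site's ratio, which is what
    \<open>slope\<close> accumulates.\<close>
  have gap: "u (a k + int t) = u (a k) + real t * D (a k) \<and>
      (int t < a (k + 1) - a k \<longrightarrow> D (a k + int t) = D (a k))"
    if "k0 \<le> k" "int t \<le> a (k + 1) - a k" for k t
    using that(2)
  proof (induction t)
    case (Suc t)
    then have IH: "u (a k + int t) = u (a k) + real t * D (a k)" "D (a k + int t) = D (a k)"
      by auto
    have "u (a k + int (Suc t)) = u (a k + int t) + D (a k + int t)"
      by (simp add: D_def algebra_simps)
    moreover have "D (a k + int (Suc t)) = D (a k)" if t: "int (Suc t) < a (k + 1) - a k"
    proof -
      have "a k + int (Suc t) \<notin> range a"
      proof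
        assume "a k + int (Suc t) \<in> range a"
        then obtain j where j: "a k + int (Suc t) = a j" by auto
        with t have "a k < a j" "a j < a (k + 1)" by auto
        then have "k < j" "j < k + 1" using strict_mono_less[OF a] by auto
        then show False by simp
      qed
      then have half': "w (a k + int (Suc t)) = 1 / 2" by (rule half)
      have "a k0 \<le> a k" using strict_mono_less_eq[OF a] \<open>k0 \<le> k\<close> by simp
      then have "D (a k + int (Suc t)) = D (a k + int (Suc t) - 1)"
        using step[of "a k + int (Suc t)", unfolded half'] by simp
      with IH show ?thesis by (simp add: algebra_simps)
    qed
    ultimately show ?case using IH by (simp add: algebra_simps)
  qed simp
  have slope: "D (a (k0 + int n)) =
      (\<Prod>j=1..n. (1 - w (a (k0 + int j))) / w (a (k0 + int j))) * D (a k0)" for n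
  proof (induction n)
    case (Suc n)
    let ?k = "k0 + int n"
    have lt: "a ?k < a (?k + 1)" "a k0 \<le> a ?k"
      using strict_mono_less[OF a] strict_mono_less_eq[OF a] by auto
    have "D (a (?k + 1) - 1) = D (a ?k)"
      using gap[of ?k "nat (a (?k + 1) - a ?k - 1)"] lt by simp
    then have "D (a (?k + 1)) = (1 - w (a (?k + 1))) / w (a (?k + 1)) * D (a ?k)"
      using step[of "a (?k + 1)"] lt by simp
    then show ?case using Suc by (simp add: algebra_simps)
  qed simp
  have D0: "0 \<le> D (a k0)" using u u0 by (simp add: D_def)
  have "real m * D (a k0) \<le> 1" for m
  proof -
    obtain n where n: "real m \<le> real_of_int (a (k0 + int n + 1) - a (k0 + int n)) *
        (\<Prod>j=1..n. (1 - w (a (k0 + int j))) / w (a (k0 + int j)))" using unb by blast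
    let ?k = "k0 + int n"
    have lt: "a ?k < a (?k + 1)" using strict_mono_less[OF a] by auto
    have "real m * D (a k0) \<le> real_of_int (a (?k + 1) - a ?k) * D (a ?k)"
      using mult_right_mono[OF n D0] by (simp add: slope mult.assoc)
    also have "\<dots> = u (a (?k + 1)) - u (a ?k)"
      using gap[of ?k "nat (a (?k + 1) - a ?k)"] lt by simp
    also have "\<dots> \<le> 1" using u[of "a (?k + 1)"] u[of "a ?k"] by linarith
    finally show ?thesis .
  qed
  then have "D (a k0) = 0"
    using D0 reals_Archimedean3[of "D (a k0)"] by (metis antisym_conv1 not_le)
  have "u i = 0 \<and> D i = 0"
    using i
  proof (induction i rule: int_ge_induct)
    case base
    show ?case using u0 \<open>D (a k0) = 0\<close> by simp
  next
    case (step i)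
    then show ?case using \<open>\<And>i. a k0 < i \<Longrightarrow> D i = _\<close>[of "i + 1"] by (simp add: D_def)
  qed
  then show ?thesis ..
qed

text \<open>The probability that the walk started at \<open>i\<close> stays in \<open>S\<close> at the times \<open>0, \<dots>, n\<close>.\<close>

primrec survival :: "(int \<Rightarrow> real) \<Rightarrow> int set \<Rightarrow> nat \<Rightarrow> int \<Rightarrow> real" where
  "survival w S 0 i = indicator S i"
| "survival w S (Suc n) i =
    indicator S i * (w i * survival w S n (i + 1) + (1 - w i) * survival w S n (i - 1))"

text \<open>Mirroring the line exchanges the probabilities of a jump to the right and to the left.
  This reduces half-lines extending to the left to those extending to the right.\<close>

lemma survival_reflect:
  "survival (\<lambda>i. 1 - w (- i)) {i. - i \<in> S} n (- i) = survival w S n i"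
proof (induction n arbitrary: i)
  case (Suc n)
  let ?s = "survival (\<lambda>i. 1 - w (- i)) {i. - i \<in> S} n"
  have "?s (- i + 1) = survival w S n (i - 1)" "?s (- i - 1) = survival w S n (i + 1)"
    using Suc[of "i - 1"] Suc[of "i + 1"] by (simp_all add: minus_diff_commute)
  then show ?case by (simp add: indicator_def)
qed (simp add: indicator_def)

lemma survival_bounds:
  assumes w: "\<And>i. 0 < w i \<and> w i < 1"
  shows "0 \<le> survival w S n i \<and> survival w S n i \<le> 1"
proof (induction n arbitrary: i)
  case (Suc n)
  have "w i * survival w S n (i + 1) + (1 - w i) * survival w S n (i - 1) \<le> w i * 1 + (1 - w i) * 1"
    using Suc w[of i] by (intro add_mono mult_left_mono) auto
  moreover have "0 \<le> w i * survival w S n (i + 1) + (1 - w i) * survival w S n (i - 1)"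
    using Suc w[of i] by (intro add_nonneg_nonneg mult_nonneg_nonneg) auto
  ultimately show ?case by (simp add: indicator_def)
qed (simp add: indicator_def)

lemma survival_antimono:
  assumes w: "\<And>i. 0 < w i \<and> w i < 1"
  shows "survival w S (Suc n) i \<le> survival w S n i"
proof (induction n arbitrary: i)
  case 0
  show ?case using survival_bounds[of w S "Suc 0" i, OF w] w[of i] by (simp add: indicator_def)
next
  case (Suc n)
  have "w i * survival w S (Suc n) (i + 1) + (1 - w i) * survival w S (Suc n) (i - 1)
      \<le> w i * survival w S n (i + 1) + (1 - w i) * survival w S n (i - 1)"
    using w[of i] by (intro add_mono mult_left_mono Suc) auto
  then show ?case
    unfolding survival.simps(2)[of w S "Suc n"] survival.simps(2)[of w S n i]
    by (intro mult_left_mono) simp_all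
qed

text \<open>Survival decreases with time, so it has a limit \<open>u\<close>, the probability of
  never leaving the half-line. Passing to the limit in the one-step recursion makes \<open>u\<close>
  harmonic inside the half-line, and \<open>harmonic_eq_0\<close> forces it to vanish.\<close>

lemma survival_tendsto_0:
  fixes w :: "int \<Rightarrow> real" and a :: "int \<Rightarrow> int"
  assumes a: "strict_mono a"
    and w: "\<And>i. 0 < w i \<and> w i < 1"
    and half: "\<And>i. i \<notin> range a \<Longrightarrow> w i = 1 / 2"
    and unb: "\<And>m::nat. \<exists>n::nat. real m \<le> real_of_int (a (k0 + int n + 1) - a (k0 + int n)) *
        (\<Prod>j=1..n. (1 - w (a (k0 + int j))) / w (a (k0 + int j)))"
  shows "(\<lambda>n. survival w {a k0<..} n i) \<longlonglongrightarrow> 0"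
proof -
  let ?s = "survival w {a k0<..}"
  define u where "u i = lim (\<lambda>n. ?s n i)" for i
  have conv: "(\<lambda>n. ?s n i) \<longlonglongrightarrow> u i" for i
  proof -
    have "decseq (\<lambda>n. ?s n i)"
      using survival_antimono[of w, OF w] by (intro decseq_SucI)
    moreover have "0 \<le> ?s n i" for n using survival_bounds[of w, OF w] by blast
    ultimately obtain L where "(\<lambda>n. ?s n i) \<longlonglongrightarrow> L"
      using decseq_convergent[of "\<lambda>n. ?s n i" 0] by blast
    then show ?thesis unfolding u_def by (simp add: limI)
  qed
  have off: "u i = 0" if "i \<le> a k0" for i
  proof -
    have "?s n i = 0" for n using that by (cases n) auto
    then show ?thesis using conv[of i] LIMSEQ_unique[of "\<lambda>_. 0::real"] by auto
  qed
  have harm: "u i = w i * u (i + 1) + (1 - w i) * u (i - 1)" if "a k0 < i" for i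
  proof (rule LIMSEQ_unique[OF LIMSEQ_Suc[OF conv]])
    have "(\<lambda>n. w i * ?s n (i + 1) + (1 - w i) * ?s n (i - 1)) \<longlonglongrightarrow>
        w i * u (i + 1) + (1 - w i) * u (i - 1)"
      by (intro tendsto_intros conv)
    then show "(\<lambda>n. ?s (Suc n) i) \<longlonglongrightarrow> w i * u (i + 1) + (1 - w i) * u (i - 1)"
      using that by simp
  qed
  have u01: "0 \<le> u i \<and> u i \<le> 1" for i
    using survival_bounds[of w, OF w] conv[of i]
    by (meson LIMSEQ_le_const LIMSEQ_le_const2)
  have "u i = 0"
    by (cases "i \<le> a k0", fact off)
      (rule harmonic_eq_0[OF a w half u01 off[OF order_refl] harm unb], auto)
  with conv[of i] show ?thesis by simp
qed

section \<open>Exit from a set under the quenched law\<close>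

lemma sets_quenched_law_Collect:
  "Measurable.pred (quenched_law w) P \<Longrightarrow> {X. P X} \<in> sets (quenched_law w)"
  by (simp add: pred_def)

text \<open>This is the Markov property in the form needed, derived from the cylinder probabilities
  alone. The prefix is arbitrary so that each induction step can move one step of the path from the
  future into the prefix. It is only an inequality, since \<open>x\<close> may already have left
  \<open>S\<close> before time \<open>n\<close>.\<close>

lemma measure_quenched_law_stay_le:
  assumes w: "\<And>i. 0 < w i \<and> w i < 1"
  shows "measure (quenched_law w) {X. (\<forall>i\<le>n. X i = x i) \<and> (\<forall>i\<le>n + k. X i \<in> S)}
    \<le> measure (quenched_law w) {X. \<forall>i\<le>n. X i = x i} * survival w S k (x n)"
proof (induction k arbitrary: n x)
  interpret Q: prob_space "quenched_law w" by (rule prob_space_quenched_law)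
  have meas [measurable]: "Measurable.pred (quenched_law w) (\<lambda>X. X i = c)" for i c
    by measurable
  have [measurable]: "Measurable.pred (quenched_law w) (\<lambda>X. X i \<in> S)" for i S
    by measurable
  have S0: "{X. \<forall>i\<le>n. X i = x i} \<in> sets (quenched_law w)" for x :: "nat \<Rightarrow> int" and n
    by (rule sets_quenched_law_Collect) measurable
  {
    case 0
    show ?case
    proof (cases "x n \<in> S")
      case True
      then show ?thesis using S0 by (auto intro!: Q.finite_measure_mono)
    next
      case False
      then have "{X. (\<forall>i\<le>n. X i = x i) \<and> (\<forall>i\<le>n + 0. X i \<in> S)} = {}" by auto
      then show ?thesis by (simp only:) (simp add: False)
    qed
  next
    case (Suc k)
    let ?Z = "{X. \<forall>i\<le>n. X i = x i}"
    \<comment> \<open>The prefix prolonged by a jump \<open>e\<close>, used with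
      \<open>e = 1\<close> and \<open>e = - 1\<close>. \<open>?Zp e\<close> is its cylinder and
      \<open>?R e\<close> the part of that cylinder that stays in \<open>S\<close>.\<close>
    define xp where "xp e = x(Suc n := x n + e)" for e
    let ?Zp = "\<lambda>e. {X. \<forall>i\<le>Suc n. X i = xp e i}"
    let ?R = "\<lambda>e. {X. (\<forall>i\<le>Suc n. X i = xp e i) \<and> (\<forall>i\<le>Suc n + k. X i \<in> S)}"
    let ?L = "{X. (\<forall>i\<le>n. X i = x i) \<and> (\<forall>i\<le>n + Suc k. X i \<in> S)}"
    have cyl: "measure (quenched_law w) {X. \<forall>i\<le>n. X i = x i} =
        (if x 0 = 0 then \<Prod>i<n. pmf (walk_step w (x i)) (x (Suc i)) else 0)" for n x
      using arg_cong[OF emeasure_quenched_law_cylinder[of w n x], of enn2real]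
      by (auto simp: measure_def prod_ennreal enn2real_ennreal prod_nonneg)
    have ext: "measure (quenched_law w) (?Zp e) =
        measure (quenched_law w) ?Z * pmf (walk_step w (x n)) (x n + e)" for e
      unfolding cyl by (auto simp: xp_def intro!: prod.cong)
    have p: "pmf (walk_step w (x n)) (x n + 1) = w (x n)"
        "pmf (walk_step w (x n)) (x n + (- 1)) = 1 - w (x n)"
      using w[of "x n"] by (auto simp: pmf_walk_step)
    have disj: "?Zp 1 \<inter> ?Zp (- 1) = {}"
    proof -
      have False if "\<forall>i\<le>Suc n. X i = xp 1 i" "\<forall>i\<le>Suc n. X i = xp (- 1) i" for X
        using that(1)[rule_format, of "Suc n"] that(2)[rule_format, of "Suc n"] by (simp add: xp_def)
      then show ?thesis by blast
    qed
    have sub: "?Zp e \<subseteq> ?Z" for e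
    proof
      fix X assume "X \<in> ?Zp e"
      then have "\<forall>i\<le>n. X i = xp e i" by auto
      then show "X \<in> ?Z" by (auto simp: xp_def)
    qed
    \<comment> \<open>Paths with prefix \<open>x\<close> whose next position is not a neighbour of
      \<open>x n\<close>. They are null because the two prolonged cylinders already exhaust the
      measure of \<open>?Z\<close>.\<close>
    let ?N = "?Z - (?Zp 1 \<union> ?Zp (- 1))"
    have "measure (quenched_law w) ?N = measure (quenched_law w) ?Z -
        measure (quenched_law w) (?Zp 1 \<union> ?Zp (- 1))"
      using S0 sub by (intro Q.finite_measure_Diff) auto
    also have "measure (quenched_law w) (?Zp 1 \<union> ?Zp (- 1)) =
        measure (quenched_law w) (?Zp 1) + measure (quenched_law w) (?Zp (- 1))"
      using S0 disj by (intro Q.finite_measure_Union) auto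
    finally have N0: "measure (quenched_law w) ?N = 0"
      unfolding ext p by (simp add: algebra_simps)
    show ?case
    proof (cases "x n \<in> S")
      case False
      have False if "\<forall>i\<le>n. X i = x i" "\<forall>i\<le>n + Suc k. X i \<in> S" for X
        using that(1)[rule_format, of n] that(2)[rule_format, of n] False by simp
      then have "?L = {}" by blast
      then show ?thesis using False by (metis (no_types, lifting) indicator_simps(2) measure_empty mult_zero_left mult_zero_right order_refl survival.simps(2))
    next
      case True
      have mR: "?R e \<in> sets (quenched_law w)" for e
        by (rule sets_quenched_law_Collect) measurable
      have mN: "?N \<in> sets (quenched_law w)" by (intro sets.Diff sets.Un S0)
      have "?L \<subseteq> (?R 1 \<union> ?R (- 1)) \<union> ?N" by (auto simp del: le_Suc_eq)
      then have "measure (quenched_law w) ?L \<le> measure (quenched_law w) ((?R 1 \<union> ?R (- 1)) \<union> ?N)"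
        using mR mN by (intro Q.finite_measure_mono) auto
      also have "\<dots> \<le> measure (quenched_law w) (?R 1) + measure (quenched_law w) (?R (- 1))
          + measure (quenched_law w) ?N"
        using mR mN measure_Un_le[of "?R 1" "quenched_law w" "?R (- 1)"]
          measure_Un_le[of "?R 1 \<union> ?R (- 1)" "quenched_law w" ?N] by fastforce
      also have "\<dots> \<le> measure (quenched_law w) (?Zp 1) * survival w S k (xp 1 (Suc n))
          + measure (quenched_law w) (?Zp (- 1)) * survival w S k (xp (- 1) (Suc n))"
        unfolding N0 using Suc[of "Suc n" "xp 1"] Suc[of "Suc n" "xp (- 1)"] by linarith
      also have "\<dots> = measure (quenched_law w) ?Z * survival w S (Suc k) (x n)"
        unfolding ext p using True by (simp add: xp_def algebra_simps)
      finally show ?thesis .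
    qed
  }
qed

text \<open>Staying in \<open>S\<close> for ever is contained in staying up to time
  \<open>k\<close>. The Markov bound with the prefix consisting of the starting point 0, which has
  full measure, gives at most \<open>survival w S k 0\<close> for each \<open>k\<close>.\<close>

lemma AE_quenched_law_exit:
  assumes w: "\<And>i. 0 < w i \<and> w i < 1"
    and lim: "(\<lambda>n. survival w S n 0) \<longlonglongrightarrow> 0"
  shows "AE X in quenched_law w. \<exists>n. X n \<notin> S"
proof -
  interpret Q: prob_space "quenched_law w" by (rule prob_space_quenched_law)
  have [measurable]: "Measurable.pred (quenched_law w) (\<lambda>X. X i \<in> S)" for i S
    by measurable
  have [measurable]: "Measurable.pred (quenched_law w) (\<lambda>X. X i = c)" for i c
    by measurable
  let ?B = "{X. \<forall>n. X n \<in> S}"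
  have B: "?B \<in> sets (quenched_law w)"
    by (rule sets_quenched_law_Collect) measurable
  have *: "{X. \<forall>i\<le>0. X i = (0::int)} \<in> sets (quenched_law w)"
    by (rule sets_quenched_law_Collect) measurable
  have 0: "measure (quenched_law w) {X. \<forall>i\<le>0. X i = 0} = 1"
    using emeasure_quenched_law_cylinder[of w 0 "\<lambda>_. 0"] by (simp add: measure_def)
  then have start: "AE X in quenched_law w. X 0 = 0"
    using Q.prob_Collect_eq_1[of "\<lambda>X. X 0 = (0::int)"] * by simp
  have "measure (quenched_law w) ?B \<le> survival w S k 0" for k
  proof -
    have "measure (quenched_law w) ?B \<le>
        measure (quenched_law w) {X. (\<forall>i\<le>0. X i = (\<lambda>_. 0) i) \<and> (\<forall>i\<le>0 + k. X i \<in> S)}"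
      using start by (intro Q.finite_measure_mono_AE sets_quenched_law_Collect) auto
    also have "\<dots> \<le> survival w S k 0"
      using measure_quenched_law_stay_le[of w 0 "\<lambda>_. 0" k S, OF w] 0 by simp
    finally show ?thesis .
  qed
  then have "measure (quenched_law w) ?B \<le> 0"
    using LIMSEQ_le_const[OF lim] by blast
  then have "measure (quenched_law w) ?B = 0" by (simp add: measure_le_0_iff)
  then show ?thesis using Q.prob_Collect_eq_0[of "\<lambda>X. \<forall>n. X n \<in> S"] B by simp
qed

section \<open>The maximal ergodic inequality and linear growth of partial sums\<close>

text \<open>The largest partial sum over at most \<open>n\<close> initial terms, the empty sum
  included. Splitting off the first term exposes the shifted sequence, which is the form that
  Garsia's argument compares with.\<close>

primrec maxsum :: "nat \<Rightarrow> (nat \<Rightarrow> real) \<Rightarrow> real" where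
  "maxsum 0 y = 0"
| "maxsum (Suc n) y = max 0 (y 0 + maxsum n (\<lambda>k. y (Suc k)))"

lemma maxsum_nonneg: "0 \<le> maxsum n y"
  by (cases n) auto

lemma sum_le_maxsum: "k \<le> n \<Longrightarrow> (\<Sum>j<k. y j) \<le> maxsum n y"
proof (induction n arbitrary: k y)
  case (Suc n)
  show ?case
  proof (cases k)
    case (Suc m)
    with Suc.IH[of m "\<lambda>k. y (Suc k)"] Suc.prems show ?thesis
      by (simp add: sum.lessThan_Suc_shift del: sum.lessThan_Suc)
  qed (simp add: maxsum_nonneg)
qed simp

lemma maxsum_le_sum_abs: "maxsum n y \<le> (\<Sum>j<n. \<bar>y j\<bar>)"
proof (induction n arbitrary: y)
  case (Suc n)
  have "maxsum (Suc n) y \<le> \<bar>y 0\<bar> + maxsum n (\<lambda>k. y (Suc k))"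
    using maxsum_nonneg[of n "\<lambda>k. y (Suc k)"] by auto
  then show ?case
    using Suc[of "\<lambda>k. y (Suc k)"] by (simp add: sum.lessThan_Suc_shift del: sum.lessThan_Suc)
qed simp

lemma maxsum_mono_Suc: "maxsum n y \<le> maxsum (Suc n) y"
proof (induction n arbitrary: y)
  case (Suc n)
  have "max 0 (y 0 + maxsum n (\<lambda>k. y (Suc k))) \<le> max 0 (y 0 + maxsum (Suc n) (\<lambda>k. y (Suc k)))"
    using Suc[of "\<lambda>k. y (Suc k)"] by (intro max.mono add_mono) auto
  then show ?case by (simp only: maxsum.simps(2)[of "Suc n" y] maxsum.simps(2)[of n y])
qed simp

lemma measurable_maxsum [measurable]: "maxsum n \<in> borel_measurable (Pi\<^sub>M UNIV (\<lambda>_. borel))"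
proof (induction n)
  case (Suc n)
  have "(\<lambda>y k. y (Suc k)) \<in> measurable (Pi\<^sub>M UNIV (\<lambda>_. borel)) (Pi\<^sub>M UNIV (\<lambda>_::nat. borel :: real measure))"
    by (rule measurable_PiM_single') (auto simp: space_PiM)
  from measurable_compose[OF this Suc]
  have [measurable]: "(\<lambda>y. maxsum n (\<lambda>k. y (Suc k))) \<in> borel_measurable (Pi\<^sub>M UNIV (\<lambda>_. borel))" .
  show ?case unfolding maxsum.simps by measurable
next
  case 0
  show ?case unfolding maxsum.simps by simp
qed

text \<open>Garsia's argument: where \<open>maxsum n > 0\<close>, the first term dominates
  \<open>maxsum n\<close> minus its shift, and by stationarity these two have the same expectation.\<close>

lemma (in prob_space) maximal_ergodic:
  fixes Y :: "nat \<Rightarrow> 'a \<Rightarrow> real"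
  assumes int: "\<And>k. integrable M (Y k)"
    and stat: "distr M (Pi\<^sub>M UNIV (\<lambda>_. borel)) (\<lambda>x k. Y (Suc k) x) =
      distr M (Pi\<^sub>M UNIV (\<lambda>_. borel)) (\<lambda>x k. Y k x)"
  shows "0 \<le> (\<integral>x. Y 0 x * indicator {x \<in> space M. 0 < maxsum n (\<lambda>k. Y k x)} x \<partial>M)"
proof -
  have [measurable]: "Y k \<in> borel_measurable M" for k using int by blast
  have Yp: "(\<lambda>x k. Y k x) \<in> measurable M (Pi\<^sub>M UNIV (\<lambda>_. borel))"
    and Ys: "(\<lambda>x k. Y (Suc k) x) \<in> measurable M (Pi\<^sub>M UNIV (\<lambda>_. borel))"
    by (rule measurable_PiM_single'; simp)+
  have intm: "integrable M (\<lambda>x. maxsum n (\<lambda>k. Y (k + i) x))" for i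
  proof (rule Bochner_Integration.integrable_bound)
    show "integrable M (\<lambda>x. \<Sum>j<n. \<bar>Y (j + i) x\<bar>)" using int by auto
    have "(\<lambda>x k. Y (k + i) x) \<in> measurable M (Pi\<^sub>M UNIV (\<lambda>_. borel))"
      by (rule measurable_PiM_single') simp_all
    from measurable_compose[OF this measurable_maxsum]
    show "(\<lambda>x. maxsum n (\<lambda>k. Y (k + i) x)) \<in> borel_measurable M" .
    show "AE x in M. norm (maxsum n (\<lambda>k. Y (k + i) x)) \<le> norm (\<Sum>j<n. \<bar>Y (j + i) x\<bar>)"
      using maxsum_le_sum_abs maxsum_nonneg by (intro AE_I2) (force intro: order_trans[OF _ abs_ge_self])
  qed
  let ?m = "\<lambda>x. maxsum n (\<lambda>k. Y k x)" and ?s = "\<lambda>x. maxsum n (\<lambda>k. Y (Suc k) x)"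
  have [measurable]: "?m \<in> borel_measurable M"
    using measurable_compose[OF Yp measurable_maxsum] .
  have im: "integrable M ?m" "integrable M ?s"
    using intm[of 0] intm[of 1] by simp_all
  have "(\<integral>x. ?s x \<partial>M) = (\<integral>y. maxsum n y \<partial>distr M (Pi\<^sub>M UNIV (\<lambda>_. borel)) (\<lambda>x k. Y (Suc k) x))"
    using Ys by (subst integral_distr) auto
  also have "\<dots> = (\<integral>x. ?m x \<partial>M)"
    unfolding stat using Yp by (subst integral_distr) auto
  finally have "0 = (\<integral>x. ?m x - ?s x \<partial>M)"
    using im by simp
  also have "\<dots> \<le> (\<integral>x. Y 0 x * indicator {x \<in> space M. 0 < ?m x} x \<partial>M)"
  proof (rule integral_mono)
    show "integrable M (\<lambda>x. ?m x - ?s x)" using im by simp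
    show "integrable M (\<lambda>x. Y 0 x * indicator {x \<in> space M. 0 < ?m x} x)"
      by (intro integrable_real_mult_indicator int) measurable
    fix x assume "x \<in> space M"
    \<comment> \<open>Raising \<open>n\<close> by one lets the recursion unfold to the shift with
      the same \<open>n\<close>. Where \<open>?m x = 0\<close> the indicator vanishes, and
      \<open>?s x\<close> being nonnegative suffices.\<close>
    moreover have "?m x \<le> max 0 (Y 0 x + ?s x)"
      using maxsum_mono_Suc[of n "\<lambda>k. Y k x"] by simp
    moreover have "0 \<le> ?m x" "0 \<le> ?s x" by (rule maxsum_nonneg)+
    ultimately show "?m x - ?s x \<le> Y 0 x * indicator {x \<in> space M. 0 < ?m x} x"
      by (auto simp: indicator_def)
  qed
  finally show ?thesis .
qed

text \<open>On \<open>A C n\<close> some partial sum of length \<open>k\<close> at most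
  \<open>n\<close> exceeds \<open>C\<close> times \<open>k\<close>. The maximal inequality for the
  sequence recentred by \<open>C\<close> bounds \<open>C\<close> times the probability of this event
  by the mean of the absolute value of \<open>Y 0\<close>, uniformly in \<open>n\<close>. Hence
  \<open>B C\<close>, the union over \<open>n\<close>, has probability of order 1/C, and the event
  that every \<open>C\<close> fails is null.\<close>

lemma (in prob_space) stationary_averages_bounded:
  fixes Y :: "nat \<Rightarrow> 'a \<Rightarrow> real"
  assumes int: "\<And>k. integrable M (Y k)"
    and stat: "distr M (Pi\<^sub>M UNIV (\<lambda>_. borel)) (\<lambda>x k. Y (Suc k) x) =
      distr M (Pi\<^sub>M UNIV (\<lambda>_. borel)) (\<lambda>x k. Y k x)"
  shows "AE x in M. \<exists>C::nat. \<forall>n. (\<Sum>j<n. Y j x) \<le> real C * real n"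
proof -
  have [measurable]: "Y k \<in> borel_measurable M" for k using int by blast
  define A where "A C n = {x \<in> space M. 0 < maxsum n (\<lambda>k. Y k x - real C)}" for C n :: nat
  have Yp: "(\<lambda>x k. Y k x) \<in> measurable M (Pi\<^sub>M UNIV (\<lambda>_. borel))"
    and Ys: "(\<lambda>x k. Y (Suc k) x) \<in> measurable M (Pi\<^sub>M UNIV (\<lambda>_. borel))"
    by (rule measurable_PiM_single'; simp)+
  have sub: "(\<lambda>y k. y k - c) \<in> measurable (Pi\<^sub>M UNIV (\<lambda>_. borel)) (Pi\<^sub>M UNIV (\<lambda>_::nat. borel :: real measure))" for c
    by (rule measurable_PiM_single') (auto simp: space_PiM)
  have A [measurable]: "A C n \<in> sets M" for C n
  proof -
    have [measurable]: "(\<lambda>x. maxsum n (\<lambda>k. Y k x - real C)) \<in> borel_measurable M"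
      using measurable_compose[OF measurable_compose[OF Yp sub] measurable_maxsum] .
    show ?thesis unfolding A_def by measurable
  qed
  have AC: "real C * prob (A C n) \<le> expectation (\<lambda>x. \<bar>Y 0 x\<bar>)" for C n
  proof -
    have iA: "integrable M (indicator (A C n) :: 'a \<Rightarrow> real)"
      by (intro integrable_real_indicator) (auto simp: emeasure_eq_measure)
    \<comment> \<open>Subtracting a constant acts coordinatewise on path space, so the recentred
      sequence is again stationary.\<close>
    have "distr M (Pi\<^sub>M UNIV (\<lambda>_. borel)) (\<lambda>x k. Y (Suc k) x - real C) =
        distr (distr M (Pi\<^sub>M UNIV (\<lambda>_. borel)) (\<lambda>x k. Y (Suc k) x))
          (Pi\<^sub>M UNIV (\<lambda>_. borel)) (\<lambda>y k. y k - real C)"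
      using sub Ys by (subst distr_distr) (auto simp: comp_def)
    also have "\<dots> = distr M (Pi\<^sub>M UNIV (\<lambda>_. borel)) (\<lambda>x k. Y k x - real C)"
      unfolding stat using sub Yp by (subst distr_distr) (auto simp: comp_def)
    finally have "0 \<le> (\<integral>x. (Y 0 x - real C) * indicator (A C n) x \<partial>M)"
      unfolding A_def using int by (intro maximal_ergodic) auto
    also have "\<dots> \<le> (\<integral>x. \<bar>Y 0 x\<bar> - real C * indicator (A C n) x \<partial>M)"
      using int by (intro integral_mono integrable_real_mult_indicator Bochner_Integration.integrable_diff
          integrable_mult_right integrable_abs iA)
        (auto simp: indicator_def)
    also have "\<dots> = expectation (\<lambda>x. \<bar>Y 0 x\<bar>) - real C * prob (A C n)"
      using int iA by (subst Bochner_Integration.integral_diff)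
        (simp_all add: integrable_mult_right)
    finally show ?thesis by simp
  qed
  define B where "B C = (\<Union>n. A C n)" for C
  have B [measurable]: "B C \<in> sets M" for C unfolding B_def by measurable
  have BC: "real C * prob (B C) \<le> expectation (\<lambda>x. \<bar>Y 0 x\<bar>)" for C
  proof -
    have "incseq (A C)"
      unfolding A_def using maxsum_mono_Suc by (intro incseq_SucI) (auto intro: less_le_trans)
    then have "(\<lambda>n. prob (A C n)) \<longlonglongrightarrow> prob (B C)"
      unfolding B_def by (intro finite_Lim_measure_incseq) auto
    from tendsto_mult_left[OF this, of "real C"] show ?thesis
      by (rule LIMSEQ_le_const2) (use AC in auto)
  qed
  have "prob (\<Inter>C. B C) \<le> 0"
  proof (rule ccontr)
    assume pos: "\<not> ?thesis"
    then obtain C :: nat where "expectation (\<lambda>x. \<bar>Y 0 x\<bar>) < real C * prob (\<Inter>C. B C)"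
      using reals_Archimedean3[of "prob (\<Inter>C. B C)"] by auto
    also have "\<dots> \<le> real C * prob (B C)"
      by (intro mult_left_mono finite_measure_mono) auto
    finally show False using BC[of C] by simp
  qed
  then have "emeasure M (\<Inter>C. B C) = 0"
    by (simp add: measure_le_0_iff emeasure_eq_measure)
  then have "AE x in M. x \<notin> (\<Inter>C. B C)"
    by (intro AE_not_in) (auto simp: null_sets_def)
  with AE_space show ?thesis
  proof eventually_elim
    case (elim x)
    then obtain C where C: "x \<notin> B C" by auto
    have "(\<Sum>j<n. Y j x) \<le> real C * real n" for n
    proof -
      have "(\<Sum>j<n. Y j x - real C) \<le> maxsum n (\<lambda>k. Y k x - real C)"
        by (rule sum_le_maxsum) simp
      also have "\<dots> \<le> 0" using C elim by (auto simp: B_def A_def not_less)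
      finally show ?thesis by (simp add: sum_subtractf mult.commute)
    qed
    then show ?case by blast
  qed
qed

section \<open>Large gaps by the second Borel-Cantelli lemma\<close>

text \<open>For positive \<open>C\<close> the infinite mean of the positive part
  (\<open>ennreal\<close> cuts off negative values) makes the probabilities of \<open>A C n\<close>
  sum to infinity. By independence, the probability that none of these events occurs in a window is
  at most the exponential of minus the sum over that window. If \<open>?E\<close> had positive
  probability, \<open>- ln (prob ?E)\<close> would bound all these sums.\<close>

lemma (in prob_space) AE_infinitely_often_ge_linear:
  fixes L :: "nat \<Rightarrow> 'a \<Rightarrow> real"
  assumes ind: "indep_vars (\<lambda>_. borel) L UNIV"
    and id: "\<And>k. distr M borel (L k) = distr M borel (L 0)"
    and inf: "(\<integral>\<^sup>+x. ennreal (L 0 x) \<partial>M) = \<infinity>"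
  shows "AE x in M. \<forall>C::nat. \<forall>m. \<exists>n\<ge>m. real C * real n \<le> L n x"
proof -
  have [measurable]: "L k \<in> borel_measurable M" for k
    using ind by (auto simp: indep_vars_def)
  define A where "A C n = {x \<in> space M. real C * real n \<le> L n x}" for C n :: nat
  have [measurable]: "A C n \<in> sets M" for C n unfolding A_def by measurable
  have pA: "prob (A C n) = prob {x \<in> space M. real C * real n \<le> L 0 x}" for C n
  proof -
    have "prob {x \<in> space M. c \<le> L k x} = measure (distr M borel (L k)) {c..}" for c k
      by (subst measure_distr) (auto intro!: arg_cong[of _ _ prob])
    then show ?thesis unfolding A_def using id[of n] by simp
  qed
  have nosum: "\<not> summable (\<lambda>n. prob (A C n))" if C: "0 < C" for C
  proof
    assume summ: "summable (\<lambda>n. prob (A C n))"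
    \<comment> \<open>For a nonnegative value, the sum counts the \<open>n\<close> from 0 to the
      integer part of \<open>L 0 x / real C\<close>. The index 0 contributes the extra 1 that
      compensates for rounding down.\<close>
    have bound: "ennreal (L 0 x) \<le> ennreal (real C) * (\<Sum>n. indicator {x \<in> space M. real C * real n \<le> L 0 x} x)"
      if x: "x \<in> space M" for x
    proof (cases "0 \<le> L 0 x")
      case True
      define N where "N = nat \<lfloor>L 0 x / real C\<rfloor>"
      have "real N = real_of_int \<lfloor>L 0 x / real C\<rfloor>"
        using True unfolding N_def by simp
      then have N: "real N \<le> L 0 x / real C" "L 0 x / real C \<le> real (Suc N)"
        by linarith+
      have "L 0 x \<le> real C * real (Suc N)" using N(2) C by (simp add: field_simps)
      then have "ennreal (L 0 x) \<le> ennreal (real C) * ennreal (real (Suc N))"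
        by (simp add: ennreal_mult[symmetric] del: of_nat_Suc)
      also have "ennreal (real (Suc N)) =
          (\<Sum>n<Suc N. indicator {x \<in> space M. real C * real n \<le> L 0 x} x)"
      proof -
        have "(\<Sum>n<Suc N. indicator {x \<in> space M. real C * real n \<le> L 0 x} x) = (\<Sum>n<Suc N. 1 :: ennreal)"
        proof (rule sum.cong)
          fix n assume "n \<in> {..<Suc N}"
          then have "real n \<le> L 0 x / real C" using N(1) by simp
          then have "real C * real n \<le> L 0 x" using C by (simp add: field_simps)
          then show "indicator {x \<in> space M. real C * real n \<le> L 0 x} x = (1::ennreal)" using x by simp
        qed simp
        then show ?thesis by (simp add: ennreal_of_nat_eq_real_of_nat del: of_nat_Suc)
      qed
      also have "\<dots> \<le> (\<Sum>n. indicator {x \<in> space M. real C * real n \<le> L 0 x} x)"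
        by (intro sum_le_suminf) auto
      finally show ?thesis by (simp add: mult_left_mono)
    qed (simp add: ennreal_neg)
    have "(\<integral>\<^sup>+x. ennreal (L 0 x) \<partial>M) \<le>
        (\<integral>\<^sup>+x. ennreal (real C) * (\<Sum>n. indicator {x \<in> space M. real C * real n \<le> L 0 x} x) \<partial>M)"
      by (intro nn_integral_mono bound)
    also have "\<dots> = ennreal (real C) * (\<Sum>n. emeasure M {x \<in> space M. real C * real n \<le> L 0 x})"
      by (simp add: nn_integral_cmult nn_integral_suminf)
    also have "\<dots> = ennreal (real C) * (\<Sum>n. ennreal (prob (A C n)))"
      by (simp add: pA emeasure_eq_measure)
    also have "\<dots> < \<infinity>"
      using summ by (simp add: suminf_ennreal2 ennreal_mult[symmetric] suminf_nonneg)
    finally show False using inf by simp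
  qed
  have main: "AE x in M. \<exists>n\<ge>m. real C * real n \<le> L n x" if C: "0 < C" for C m :: nat
  proof -
    let ?F = "\<lambda>N. {x \<in> space M. \<forall>n\<in>{m..<m + N}. \<not> real C * real n \<le> L n x}"
    let ?E = "{x \<in> space M. \<forall>n\<ge>m. \<not> real C * real n \<le> L n x}"
    have F: "prob (?F N) \<le> exp (- (\<Sum>n\<in>{m..<m + N}. prob (A C n)))" if "N > 0" for N
    proof -
      have "?F N = (\<Inter>n\<in>{m..<m + N}. L n -` {..<real C * real n} \<inter> space M)"
        using that by (auto simp: not_le)
      also have "prob \<dots> = (\<Prod>n\<in>{m..<m + N}. prob (L n -` {..<real C * real n} \<inter> space M))"
        using that by (intro indep_varsD[OF ind]) auto
      also have "\<dots> = (\<Prod>n\<in>{m..<m + N}. 1 - prob (A C n))"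
      proof (rule prod.cong)
        fix n
        have "L n -` {..<real C * real n} \<inter> space M = space M - A C n"
          by (auto simp: A_def)
        then show "prob (L n -` {..<real C * real n} \<inter> space M) = 1 - prob (A C n)"
          by (simp add: prob_compl)
      qed simp
      also have "\<dots> \<le> (\<Prod>n\<in>{m..<m + N}. exp (- prob (A C n)))"
        using exp_ge_add_one_self[of "- prob (A C _)"] by (intro prod_mono) (auto simp: prob_le_1)
      also have "\<dots> = exp (- (\<Sum>n\<in>{m..<m + N}. prob (A C n)))"
        by (simp add: exp_sum[symmetric] sum_negf)
      finally show ?thesis .
    qed
    have [measurable]: "?E \<in> sets M" by measurable
    have "prob ?E \<le> 0"
    proof (rule ccontr)
      assume "\<not> ?thesis"
      then have pos: "0 < prob ?E" by simp
      have b: "(\<Sum>n\<in>{m..<m + N}. prob (A C n)) \<le> - ln (prob ?E)" if N: "0 < N" for N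
      proof -
        have "prob ?E \<le> prob (?F N)" by (intro finite_measure_mono) auto
        with F[OF N] have "prob ?E \<le> exp (- (\<Sum>n\<in>{m..<m + N}. prob (A C n)))" by linarith
        with pos have "ln (prob ?E) \<le> ln (exp (- (\<Sum>n\<in>{m..<m + N}. prob (A C n))))"
          by (subst ln_le_cancel_iff) auto
        then show ?thesis by simp
      qed
      have "summable (\<lambda>n. prob (A C (n + m)))"
      proof (rule summableI_nonneg_bounded)
        fix N
        have "(\<Sum>n<N. prob (A C (n + m))) = (\<Sum>n\<in>{m..<m + N}. prob (A C n))"
          by (rule sum.reindex_bij_witness[of _ "\<lambda>n. n - m" "\<lambda>n. n + m"]) auto
        \<comment> \<open>One more term keeps the window nonempty, as \<open>b\<close>
          requires.\<close>
        also have "\<dots> \<le> (\<Sum>n\<in>{m..<m + Suc N}. prob (A C n))"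
          by (intro sum_mono2) auto
        also have "\<dots> \<le> - ln (prob ?E)" by (rule b) simp
        finally show "(\<Sum>n<N. prob (A C (n + m))) \<le> - ln (prob ?E)" .
      qed simp
      then show False using nosum[OF C] summable_iff_shift[of "\<lambda>n. prob (A C n)"] by blast
    qed
    then have "prob ?E = 0" by (simp add: measure_le_0_iff)
    then have "AE x in M. \<not> (\<forall>n\<ge>m. \<not> real C * real n \<le> L n x)"
      by (subst (asm) prob_Collect_eq_0) auto
    then show ?thesis by auto
  qed
  \<comment> \<open>\<open>main\<close> asks for a positive constant; the bound with
    \<open>Suc C\<close> implies the one with \<open>C\<close>, including
    \<open>C = 0\<close>.\<close>
  have "AE x in M. \<forall>C::nat. \<forall>m. \<exists>n\<ge>m. real (Suc C) * real n \<le> L n x"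
    by (simp add: AE_all_countable main del: of_nat_Suc)
  then show ?thesis
  proof eventually_elim
    case (elim x)
    have "real C * real n \<le> real (Suc C) * real n" for C n by (simp add: algebra_simps)
    then show ?case using elim by (meson order_trans)
  qed
qed

section \<open>Independent and stationary families along an index map\<close>

text \<open>Lets Borel-Cantelli run through the gaps to the right or to the left of any site.
  Injectivity makes different positions use different variables, so the product over
  \<open>J\<close> is one over the image of \<open>J\<close>.\<close>

lemma (in prob_space) indep_vars_reindex:
  assumes s: "inj s" and ind: "indep_vars (\<lambda>_. N) X UNIV"
  shows "indep_vars (\<lambda>_. N) (\<lambda>n. X (s n)) UNIV"
proof -
  let ?F = "\<lambda>i. {X i -` A \<inter> space M |A. A \<in> sets N}"
  have rv: "random_variable N (X i)" for i
    using ind unfolding indep_vars_def2 by blast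
  have F: "indep_sets ?F UNIV"
    using ind unfolding indep_vars_def2 by blast
  have "indep_sets (\<lambda>n. ?F (s n)) UNIV"
  proof (rule indep_setsI)
    show "?F (s n) \<subseteq> events" for n
      using rv by (auto intro: measurable_sets)
    fix A J
    assume J: "J \<noteq> {}" "finite J" and A: "\<forall>j\<in>J. A j \<in> ?F (s j)"
    have "prob (\<Inter>i\<in>s ` J. A (inv s i)) = (\<Prod>i\<in>s ` J. prob (A (inv s i)))"
      using A J s by (intro indep_setsD[OF F]) auto
    then show "prob (\<Inter>j\<in>J. A j) = (\<Prod>j\<in>J. prob (A j))"
      using s by (simp add: prod.reindex inj_on_subset[OF s])
  qed
  then show ?thesis using rv unfolding indep_vars_def2 by auto
qed

text \<open>Reading coordinates along \<open>s\<close> and applying \<open>g\<close> is a measurable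
  map of two-sided paths, so it carries the equality of laws along. As \<open>s\<close> is
  arbitrary, it may also run backwards or be constant.\<close>

lemma stationary_sequence_reindex:
  assumes stat: "stationary_sequence M N Z" and g [measurable]: "g \<in> borel_measurable N"
  shows "distr M (Pi\<^sub>M UNIV (\<lambda>_. borel)) (\<lambda>x j. g (Z (s j + 1) x)) =
    distr M (Pi\<^sub>M UNIV (\<lambda>_. borel)) (\<lambda>x j. g (Z (s j) x))"
proof -
  have Z [measurable]: "Z k \<in> measurable M N" for k
    using stat by (auto simp: stationary_sequence_def)
  have eq: "distr M (Pi\<^sub>M UNIV (\<lambda>_. N)) (\<lambda>x k. Z (k + 1) x) = distr M (Pi\<^sub>M UNIV (\<lambda>_. N)) (\<lambda>x k. Z k x)"
    using stat by (auto simp: stationary_sequence_def)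
  have Z': "(\<lambda>x k. Z (k + i) x) \<in> measurable M (Pi\<^sub>M UNIV (\<lambda>_. N))" for i
    by (rule measurable_PiM_single') (auto simp: measurable_space[OF Z])
  have p: "(\<lambda>y j. g (y (s j))) \<in> measurable (Pi\<^sub>M UNIV (\<lambda>_. N)) (Pi\<^sub>M UNIV (\<lambda>_. borel))"
    by (rule measurable_PiM_single') (auto simp: space_PiM)
  have *: "distr (distr M (Pi\<^sub>M UNIV (\<lambda>_. N)) (\<lambda>x k. Z (k + i) x)) (Pi\<^sub>M UNIV (\<lambda>_. borel)) (\<lambda>y j. g (y (s j)))
      = distr M (Pi\<^sub>M UNIV (\<lambda>_. borel)) (\<lambda>x j. g (Z (s j + i) x))" for i
    using p Z' by (subst distr_distr) (auto simp: comp_def)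
  show ?thesis using *[of 1] *[of 0] eq by simp
qed

lemma stationary_sequence_distr:
  assumes stat: "stationary_sequence M N Z" and g [measurable]: "g \<in> borel_measurable N"
  shows "distr M borel (\<lambda>x. g (Z k x)) = distr M borel (\<lambda>x. g (Z 0 x))"
proof -
  have Z [measurable]: "Z k \<in> measurable M N" for k
    using stat by (auto simp: stationary_sequence_def)
  have step: "distr M borel (\<lambda>x. g (Z (k + 1) x)) = distr M borel (\<lambda>x. g (Z k x))" for k
  proof -
    have *: "distr (distr M (Pi\<^sub>M UNIV (\<lambda>_::nat. borel)) (\<lambda>x j. g (Z l x))) borel (\<lambda>y. y 0) =
        distr M borel (\<lambda>x. g (Z l x))" for l
    proof -
      have "(\<lambda>x j. g (Z l x)) \<in> measurable M (Pi\<^sub>M UNIV (\<lambda>_::nat. borel))"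
        by (rule measurable_PiM_single') auto
      then show ?thesis by (subst distr_distr) (auto simp: comp_def)
    qed
    \<comment> \<open>With the constant index map \<open>k\<close> every coordinate is the same
      variable, and coordinate 0 recovers its law.\<close>
    show ?thesis
      using arg_cong[OF stationary_sequence_reindex[OF stat g, of "\<lambda>_::nat. k"],
          of "\<lambda>D. distr D borel (\<lambda>y. y 0)"] unfolding * .
  qed
  show ?thesis
  proof (induction k rule: int_induct[where k = 0])
    case (step2 i)
    then show ?case using step[of "i - 1"] by simp
  qed (simp_all add: step)
qed

section \<open>Oscillation in a fixed environment\<close>

text \<open>The product is at least exp(-C n). Choosing \<open>n\<close> at least \<open>m\<close>
  with \<open>ln (D n)\<close> at least \<open>Suc C\<close> times \<open>n\<close> leaves a surplus
  factor exp(n), which exceeds \<open>m\<close>. The absolute values let one bound serve both the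
  ratios and their inverses.\<close>

lemma exp_growth_beats_product:
  fixes x D :: "nat \<Rightarrow> real"
  assumes x: "\<And>j. 0 < x j" and D: "\<And>n. 0 < D n"
    and C: "\<And>n. (\<Sum>j<n. \<bar>ln (x (Suc j))\<bar>) \<le> real C * real n"
    and io: "\<And>C m. \<exists>n\<ge>m. real C * real n \<le> ln (D n)"
  shows "\<exists>n. real m \<le> D n * (\<Prod>j=1..n. x j)"
proof -
  obtain n where n: "m \<le> n" "real (Suc C) * real n \<le> ln (D n)" using io by blast
  have "(\<Prod>j=1..n. x j) = (\<Prod>j<n. x (Suc j))"
    by (rule prod.reindex_bij_witness[of _ Suc "\<lambda>j. j - 1"]) auto
  also have "\<dots> = exp (\<Sum>j<n. ln (x (Suc j)))"
    using x by (simp add: exp_sum)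
  finally have prod: "(\<Prod>j=1..n. x j) = exp (\<Sum>j<n. ln (x (Suc j)))" .
  have "\<bar>\<Sum>j<n. ln (x (Suc j))\<bar> \<le> real C * real n"
    using C[of n] sum_abs[of "\<lambda>j. ln (x (Suc j))" "{..<n}"] by linarith
  then have "real n \<le> ln (D n) + (\<Sum>j<n. ln (x (Suc j)))"
    using n(2) by (simp add: algebra_simps)
  then have "real n \<le> exp (ln (D n) + (\<Sum>j<n. ln (x (Suc j))))"
    using exp_ge_add_one_self[of "ln (D n) + (\<Sum>j<n. ln (x (Suc j)))"] by linarith
  also have "\<dots> = D n * (\<Prod>j=1..n. x j)"
    unfolding prod exp_add using D[of n] by simp
  finally show ?thesis using n(1) by (intro exI[of _ n]) simp
qed

lemma strict_mono_int_unbounded: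
  fixes a :: "int \<Rightarrow> int"
  assumes a: "strict_mono a"
  shows "\<exists>k. b \<le> a k" "\<exists>k. a k \<le> b"
proof -
  have less: "a k + 1 \<le> a (k + 1)" for k using strict_mono_less[OF a, of k "k + 1"] by simp
  have up: "a 0 + int n \<le> a (int n)" for n
  proof (induction n)
    case (Suc n)
    then show ?case using less[of "int n"] by (simp add: add.commute)
  qed simp
  have down: "a (- int n) \<le> a 0 - int n" for n
  proof (induction n)
    case (Suc n)
    then show ?case using less[of "- int (Suc n)"] by simp
  qed simp
  show "\<exists>k. b \<le> a k" using up[of "nat (b - a 0)"] by (intro exI[of _ "int (nat (b - a 0))"]) linarith
  show "\<exists>k. a k \<le> b" using down[of "nat (a 0 - b)"] by (intro exI[of _ "- int (nat (a 0 - b))"]) linarith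
qed

text \<open>A single visit below each level is enough: finitely many initial values have a minimum,
  so visits below lower levels must come late.\<close>

lemma liminf_int_eq_minus_infinity:
  fixes X :: "nat \<Rightarrow> int"
  assumes X: "\<And>b. \<exists>n. X n \<le> b"
  shows "liminf (\<lambda>n. ereal (real_of_int (X n))) = - \<infinity>"
proof (rule ccontr)
  assume "\<not> ?thesis"
  then have "- \<infinity> < liminf (\<lambda>n. ereal (real_of_int (X n)))" by simp
  then obtain r where r: "ereal r < liminf (\<lambda>n. ereal (real_of_int (X n)))"
    using ereal_dense2[of "- \<infinity>"] by auto
  then have "eventually (\<lambda>n. ereal r < ereal (real_of_int (X n))) sequentially"
    by (rule less_LiminfD)
  then obtain N where N: "\<And>n. N \<le> n \<Longrightarrow> r < real_of_int (X n)"
    by (auto simp: eventually_sequentially)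
  \<comment> \<open>At most \<open>r\<close>, which rules out times from \<open>N\<close> on, and
    below every earlier value. \<open>insert 0\<close> keeps the set nonempty when
    \<open>N = 0\<close>.\<close>
  define b where "b = min \<lfloor>r\<rfloor> (Min (insert 0 (X ` {..<N})) - 1)"
  obtain n where n: "X n \<le> b" using X by blast
  show False
  proof (cases "n < N")
    case True
    then have "Min (insert 0 (X ` {..<N})) \<le> X n" by (intro Min_le) auto
    with n show False unfolding b_def by linarith
  next
    case False
    then have "r < real_of_int (X n)" by (intro N) simp
    moreover have "X n \<le> \<lfloor>r\<rfloor>" using n by (simp add: b_def)
    ultimately show False by linarith
  qed
qed

lemma limsup_int_eq_infinity:
  fixes X :: "nat \<Rightarrow> int"
  assumes X: "\<And>b. \<exists>n. b \<le> X n"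
  shows "limsup (\<lambda>n. ereal (real_of_int (X n))) = \<infinity>"
proof -
  have "liminf (\<lambda>n. ereal (real_of_int (- X n))) = - \<infinity>"
    using X by (intro liminf_int_eq_minus_infinity) (metis minus_le_iff)
  then show ?thesis
    using ereal_Liminf_uminus[of sequentially "\<lambda>n. ereal (real_of_int (X n))"] by simp
qed

text \<open>Almost surely the walk leaves each of the countably many half-lines ending at a site.
  Sites are unbounded in both directions, so the walk gets below and above every level.\<close>

lemma AE_quenched_law_oscillates:
  fixes w :: "int \<Rightarrow> real" and a :: "int \<Rightarrow> int"
  assumes a: "strict_mono a"
    and w: "\<And>i. 0 < w i \<and> w i < 1"
    and half: "\<And>i. i \<notin> range a \<Longrightarrow> w i = 1 / 2"
    and right: "\<And>k0 m. \<exists>n::nat. real m \<le> real_of_int (a (k0 + int n + 1) - a (k0 + int n)) *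
        (\<Prod>j=1..n. (1 - w (a (k0 + int j))) / w (a (k0 + int j)))"
    and left: "\<And>k0 m. \<exists>n::nat. real m \<le> real_of_int (a (k0 - int n) - a (k0 - int n - 1)) *
        (\<Prod>j=1..n. w (a (k0 - int j)) / (1 - w (a (k0 - int j))))"
  shows "AE X in quenched_law w. liminf (\<lambda>n. ereal (real_of_int (X n))) = - \<infinity> \<and>
    limsup (\<lambda>n. ereal (real_of_int (X n))) = \<infinity>"
proof -
  have R: "(\<lambda>n. survival w {a k0<..} n 0) \<longlonglongrightarrow> 0" for k0
    by (rule survival_tendsto_0[OF a w half right])
  have L: "(\<lambda>n. survival w {..<a k0} n 0) \<longlonglongrightarrow> 0" for k0
  proof -
    \<comment> \<open>The mirrored environment and sites: \<open>{..<a k0}\<close> becomes the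
      half-line to the right of \<open>?a (- k0)\<close>, and the ratios of \<open>?w\<close> are
      the inverse ratios in \<open>left\<close>.\<close>
    let ?w = "\<lambda>i. 1 - w (- i)" and ?a = "\<lambda>k. - a (- k)"
    have "(\<lambda>n. survival ?w {?a (- k0)<..} n (- 0)) \<longlonglongrightarrow> 0"
    proof (rule survival_tendsto_0[of ?a ?w "- k0" "- 0"])
      show "strict_mono ?a" using a by (auto simp: strict_mono_def)
      show "0 < ?w i \<and> ?w i < 1" for i using w[of "- i"] by simp
      show "?w i = 1 / 2" if "i \<notin> range ?a" for i
      proof -
        have "- i \<notin> range a"
        proof
          assume "- i \<in> range a"
          then obtain k where "- i = a k" by auto
          then have "i = ?a (- k)" by simp
          with that show False by blast
        qed
        then show ?thesis using half by simp
      qed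
      fix m :: nat
      obtain n where "real m \<le> real_of_int (a (k0 - int n) - a (k0 - int n - 1)) *
        (\<Prod>j=1..n. w (a (k0 - int j)) / (1 - w (a (k0 - int j))))" using left by blast
      then show "\<exists>n::nat. real m \<le> real_of_int (?a (- k0 + int n + 1) - ?a (- k0 + int n)) *
        (\<Prod>j=1..n. (1 - ?w (?a (- k0 + int j))) / ?w (?a (- k0 + int j)))"
        by (intro exI[of _ n]) (simp add: algebra_simps)
    qed
    moreover have "{?a (- k0)<..} = {i. - i \<in> {..<a k0}}" by auto
    ultimately show ?thesis unfolding survival_reflect[symmetric, of w "{..<a k0}" _ 0] by simp
  qed
  have "AE X in quenched_law w. \<forall>k. (\<exists>n. X n \<notin> {a k<..}) \<and> (\<exists>n. X n \<notin> {..<a k})"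
    unfolding AE_all_countable using AE_quenched_law_exit[OF w R] AE_quenched_law_exit[OF w L] by auto
  then show ?thesis
  proof eventually_elim
    case (elim X)
    have "\<exists>n. X n \<le> b" for b
    proof -
      obtain k where "a k \<le> b" using strict_mono_int_unbounded(2)[OF a] by blast
      moreover obtain n where "X n \<notin> {a k<..}" using elim by blast
      ultimately show ?thesis by (intro exI[of _ n]) simp
    qed
    moreover have "\<exists>n. b \<le> X n" for b
    proof -
      obtain k where "b \<le> a k" using strict_mono_int_unbounded(1)[OF a] by blast
      moreover obtain n where "X n \<notin> {..<a k}" using elim by blast
      ultimately show ?thesis by (intro exI[of _ n]) simp
    qed
    ultimately show ?case
      using liminf_int_eq_minus_infinity limsup_int_eq_infinity by blast
  qed
qed

section \<open>Almost every environment, and the annealed law\<close>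

theorem theorem2:
  fixes M :: "'w measure"
    and lam :: "int \<Rightarrow> 'w \<Rightarrow> real"
    and d :: "int \<Rightarrow> 'w \<Rightarrow> nat"
  assumes "prob_space M"
    and "\<And>k. lam k \<in> borel_measurable M"
    and "\<And>k. d k \<in> measurable M (count_space UNIV)"
    and "\<And>k x. x \<in> space M \<Longrightarrow> 0 < lam k x \<and> lam k x < 1"
    and "\<And>k x. x \<in> space M \<Longrightarrow> 1 \<le> d k x"
    and "stationary_sequence M (count_space UNIV \<Otimes>\<^sub>M borel) (\<lambda>k x. (d k x, lam k x))"
    and "ergodic_sequence M (count_space UNIV \<Otimes>\<^sub>M borel) (\<lambda>k x. (d k x, lam k x))"
    and "prob_space.indep_vars M (\<lambda>_. count_space UNIV) d UNIV"
    and "\<And>k. distr M (count_space UNIV) (d k) = distr M (count_space UNIV) (d 0)"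
    and "(\<integral>\<^sup>+x. ennreal \<bar>ln ((1 - lam 0 x) / lam 0 x)\<bar> \<partial>M) < \<infinity>"
    and "(\<integral>\<^sup>+x. ennreal (ln (real (d 0 x))) \<partial>M) = \<infinity>"
  shows "AE (x, X) in annealed_law M (\<lambda>x. sparse_env (\<lambda>k. lam k x) (\<lambda>k. d k x)).
           liminf (\<lambda>n. ereal (real_of_int (X n))) = - \<infinity> \<and>
           limsup (\<lambda>n. ereal (real_of_int (X n))) = \<infinity>"
proof -
  interpret prob_space M by fact
  note [measurable] = assms(2,3)
  note lam = assms(4) and d = assms(5) and stat = assms(6)
  let ?env = "\<lambda>x. sparse_env (\<lambda>k. lam k x) (\<lambda>k. d k x)"
  define Y where "Y k x = \<bar>ln ((1 - lam k x) / lam k x)\<bar>" for k x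
  \<comment> \<open>Writes \<open>Y k\<close> as one fixed function of the \<open>k\<close>-th pair,
    so that the stationarity of the pairs passes to \<open>Y\<close>.\<close>
  define g where "g p = \<bar>ln ((1 - snd p) / snd p)\<bar>" for p :: "nat \<times> real"
  have g [measurable]: "g \<in> borel_measurable (count_space UNIV \<Otimes>\<^sub>M borel)"
    unfolding g_def by measurable
  have Yg: "Y k x = g (d k x, lam k x)" for k x by (simp add: Y_def g_def)
  have [measurable]: "Y k \<in> borel_measurable M" for k unfolding Y_def by measurable
  have intY: "integrable M (Y k)" for k
  proof -
    have "(\<integral>\<^sup>+x. ennreal (Y k x) \<partial>M) = (\<integral>\<^sup>+y. ennreal y \<partial>distr M borel (Y k))"
      by (subst nn_integral_distr) auto
    also have "distr M borel (Y k) = distr M borel (Y 0)"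
      using stationary_sequence_distr[OF stat g, of k] by (simp add: Yg[symmetric])
    also have "(\<integral>\<^sup>+y. ennreal y \<partial>distr M borel (Y 0)) = (\<integral>\<^sup>+x. ennreal (Y 0 x) \<partial>M)"
      by (subst nn_integral_distr) auto
    also have "\<dots> < \<infinity>" using assms(10) by (simp add: Y_def)
    finally show ?thesis by (intro integrableI_nonneg) (auto simp: Y_def)
  qed
  have statY: "distr M (Pi\<^sub>M UNIV (\<lambda>_. borel)) (\<lambda>x j. Y (s j + 1) x) =
      distr M (Pi\<^sub>M UNIV (\<lambda>_. borel)) (\<lambda>x j. Y (s j) x)" for s :: "nat \<Rightarrow> int"
    using stationary_sequence_reindex[OF stat g, of s] by (simp add: Yg[symmetric])
  have avg_right: "AE x in M. \<exists>C::nat. \<forall>n. (\<Sum>j<n. Y (k + int j + 1) x) \<le> real C * real n" for k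
    using statY[of "\<lambda>j. k + int j + 1"]
    by (intro stationary_averages_bounded intY) (simp add: algebra_simps)
  \<comment> \<open>The sequence runs leftwards while stationarity shifts rightwards. Starting at
    \<open>- 2\<close> makes the shifted sequence the wanted one and the unshifted sequence its
    tail, so the required equality of laws is read backwards.\<close>
  have avg_left: "AE x in M. \<exists>C::nat. \<forall>n. (\<Sum>j<n. Y (k - int j - 1) x) \<le> real C * real n" for k
    using statY[of "\<lambda>j. k - int j - 2"]
    by (intro stationary_averages_bounded intY) (simp add: algebra_simps)
  have io: "AE x in M. \<forall>C::nat. \<forall>m. \<exists>n\<ge>m. real C * real n \<le> ln (real (d (s n) x))"
    if s: "inj s" for s :: "nat \<Rightarrow> int"
  proof (rule AE_infinitely_often_ge_linear)
    show "indep_vars (\<lambda>_. borel) (\<lambda>n x. ln (real (d (s n) x))) UNIV"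
      by (rule indep_vars_compose2[OF indep_vars_reindex[OF s assms(8)]]) simp
    have eq: "distr M borel (\<lambda>x. ln (real (d k x))) = distr M borel (\<lambda>x. ln (real (d 0 x)))" for k
    proof -
      have "distr M borel (\<lambda>x. ln (real (d l x))) =
          distr (distr M (count_space UNIV) (d l)) borel (\<lambda>e. ln (real e))" for l
        by (subst distr_distr) (auto simp: comp_def)
      then show ?thesis using assms(9)[of k] by simp
    qed
    show "distr M borel (\<lambda>x. ln (real (d (s n) x))) = distr M borel (\<lambda>x. ln (real (d (s 0) x)))" for n
      using eq[of "s n"] eq[of "s 0"] by simp
    have "(\<integral>\<^sup>+x. ennreal (ln (real (d (s 0) x))) \<partial>M) =
        (\<integral>\<^sup>+y. ennreal y \<partial>distr M borel (\<lambda>x. ln (real (d (s 0) x))))"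
      by (subst nn_integral_distr) auto
    also have "\<dots> = (\<integral>\<^sup>+x. ennreal (ln (real (d 0 x))) \<partial>M)"
      unfolding eq[of "s 0"] by (subst nn_integral_distr) auto
    finally show "(\<integral>\<^sup>+x. ennreal (ln (real (d (s 0) x))) \<partial>M) = \<infinity>"
      using assms(11) by simp
  qed
  have env01: "0 < ?env x i \<and> ?env x i < 1" if "x \<in> space M" for x i
    using lam[OF that] by (auto simp: sparse_env_def)
  \<comment> \<open>One almost sure event serves all integers \<open>k\<close>. The gap to the right
    of site \<open>k + int n\<close> has length \<open>d (k + int n + 1)\<close>, the gap to the
    left of site \<open>k - int n\<close> has length \<open>d (k - int n)\<close>.\<close>
  have "AE x in M. x \<in> space M \<and>
      (\<forall>k. (\<exists>C::nat. \<forall>n. (\<Sum>j<n. Y (k + int j + 1) x) \<le> real C * real n) \<and>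
        (\<exists>C::nat. \<forall>n. (\<Sum>j<n. Y (k - int j - 1) x) \<le> real C * real n) \<and>
        (\<forall>C::nat. \<forall>m. \<exists>n\<ge>m. real C * real n \<le> ln (real (d (k + int n + 1) x))) \<and>
        (\<forall>C::nat. \<forall>m. \<exists>n\<ge>m. real C * real n \<le> ln (real (d (k - int n) x))))"
    unfolding AE_conj_iff AE_all_countable[where 'i = int]
    by (intro conjI allI AE_space avg_right avg_left io) (auto simp: inj_def)
  then have quenched: "AE x in M. AE X in quenched_law (?env x).
      liminf (\<lambda>n. ereal (real_of_int (X n))) = - \<infinity> \<and>
      limsup (\<lambda>n. ereal (real_of_int (X n))) = \<infinity>"
  proof eventually_elim
    case (elim x)
    then have x: "x \<in> space M" by blast
    let ?a = "sparse_site (\<lambda>k. d k x)"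
    have site: "?env x (?a k) = lam k x" for k
      using d[OF x] by (intro sparse_env_site)
    have pos: "0 < (1 - lam k x) / lam k x" "0 < lam k x / (1 - lam k x)" "0 < real (d k x)" for k
      using lam[OF x, of k] d[OF x, of k] by auto
    \<comment> \<open>Inverting a ratio only changes the sign of its logarithm, so the same averages
      control the products to the left.\<close>
    have Y': "Y k x = \<bar>ln (lam k x / (1 - lam k x))\<bar>" for k
      using lam[OF x, of k] by (simp add: Y_def ln_div abs_minus_commute)
    show ?case
    proof (rule AE_quenched_law_oscillates)
      show "strict_mono ?a" using d[OF x] by (rule sparse_site_strict_mono)
      show "0 < ?env x i \<and> ?env x i < 1" for i by (rule env01[OF x])
      show "?env x i = 1 / 2" if "i \<notin> range ?a" for i
        using that by (auto simp: sparse_env_def)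
      fix k0 :: int and m :: nat
      have stp: "?a (k + 1) - ?a k = int (d (k + 1) x)" "?a k - ?a (k - 1) = int (d k x)" for k
        using sparse_site_step[of "\<lambda>k. d k x" "k + 1"] sparse_site_step[of "\<lambda>k. d k x" k] by simp_all
      obtain C where C: "\<And>n. (\<Sum>j<n. Y (k0 + int j + 1) x) \<le> real C * real n"
        using elim by blast
      show "\<exists>n::nat. real m \<le> real_of_int (?a (k0 + int n + 1) - ?a (k0 + int n)) *
        (\<Prod>j=1..n. (1 - ?env x (?a (k0 + int j))) / ?env x (?a (k0 + int j)))"
        unfolding stp site of_int_of_nat_eq
      proof (rule exp_growth_beats_product[OF pos(1,3)])
        show "(\<Sum>j<n. \<bar>ln ((1 - lam (k0 + int (Suc j)) x) / lam (k0 + int (Suc j)) x)\<bar>)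
            \<le> real C * real n" for n
          using C[of n] by (simp add: Y_def algebra_simps)
        show "\<exists>n\<ge>m. real C * real n \<le> ln (real (d (k0 + int n + 1) x))" for C m
          using elim by blast
      qed
      obtain C where C: "\<And>n. (\<Sum>j<n. Y (k0 - int j - 1) x) \<le> real C * real n"
        using elim by blast
      show "\<exists>n::nat. real m \<le> real_of_int (?a (k0 - int n) - ?a (k0 - int n - 1)) *
        (\<Prod>j=1..n. ?env x (?a (k0 - int j)) / (1 - ?env x (?a (k0 - int j))))"
        unfolding stp site of_int_of_nat_eq
      proof (rule exp_growth_beats_product[OF pos(2,3)])
        show "(\<Sum>j<n. \<bar>ln (lam (k0 - int (Suc j)) x / (1 - lam (k0 - int (Suc j)) x))\<bar>)
            \<le> real C * real n" for n
          using C[of n] by (simp add: Y' algebra_simps)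
        show "\<exists>n\<ge>m. real C * real n \<le> ln (real (d (k0 - int n) x))" for C m
          using elim by blast
      qed
    qed
  qed
  have Q: "(\<lambda>x. quenched_law (?env x)) \<in> measurable M (subprob_algebra walk_paths)"
    using env01 by (intro measurable_quenched_law measurable_sparse_env assms(2,3) d)
      (auto intro: less_imp_le)
  have K: "(\<lambda>x. distr (quenched_law (?env x)) (M \<Otimes>\<^sub>M walk_paths) (\<lambda>X. (x, X)))
      \<in> measurable M (subprob_algebra (M \<Otimes>\<^sub>M walk_paths))"
    by (rule measurable_distr2[OF _ Q]) simp_all
  let ?P = "\<lambda>z. liminf (\<lambda>n. ereal (real_of_int (snd z n))) = - \<infinity> \<and>
      limsup (\<lambda>n. ereal (real_of_int (snd z n))) = \<infinity>"
  have P [measurable]: "Measurable.pred (M \<Otimes>\<^sub>M walk_paths) ?P"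
    by measurable
  have "AE x in M. AE z in distr (quenched_law (?env x)) (M \<Otimes>\<^sub>M walk_paths) (\<lambda>X. (x, X)). ?P z"
    using quenched AE_space
  proof eventually_elim
    case (elim x)
    have "Pair x \<in> measurable (quenched_law (?env x)) (M \<Otimes>\<^sub>M walk_paths)"
      using elim by (simp add: measurable_cong_sets[OF sets_quenched_law refl])
    then show ?case using elim P by (subst AE_distr_iff) (auto simp: pred_def)
  qed
  then have "AE z in annealed_law M ?env. ?P z"
    unfolding annealed_law_def by (subst AE_bind[OF K P])
  then show ?thesis by (simp add: case_prod_beta)
qed

end
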